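(* Let $q\ge 1$ be an integer and $\chi$ a Dirichlet character modulo $q$, and for primes $p\nmid q$ write $\chi(p)=e^{i\theta_p}$ with $\theta_p\in\mathbb{R}$. Let $p_1<p_2<\cdots$ be the primes in increasing order. Fix a positive integer $M$, let $m_1,m_2,\dots$ be independent random variables, each uniformly distributed on $\{0,1,\dots,M\}$, and set $p'_n=p_n+m_n q$ (so $p'_n\equiv p_n \pmod q$ and $\theta_{p'_n}:=\theta_{p_n}$). For real $t$ define $$B'_N(t)=\sum_{\substack{n=1\\ p_n\nmid q}}^{N}\cos\bigl(t\log p'_n-\theta_{p'_n}\bigr).$$ If for every $\epsilon>0$ and every $t\in\mathbb{R}$, with probability equal to $1$ one has $B'_N(t)=O(N^{1/2+\epsilon})$ as $N\to\infty$, then the Riemann Hypothesis holds for the Dirichlet $L$-function $L(s,\chi)=\sum_{m\ge1}\chi(m)m^{-s}$, i.e. all its non-trivial zeros lie on the line $\Re(s)=\tfrac12$.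
   Context: The random sequence $(p'_n)$ is called a state of the "random-prime ensemble"; the actual primes correspond to the state with all $m_n=0$. Here $O(N^{1/2+\epsilon})$ may be relaxed by logarithmic factors such as powers of $\log N$ or $\log\log N$. Non-trivial zeros of $L(s,\chi)$ are those in the critical strip $0<\Re(s)<1$. *)

theory Defs
  imports "HOL-Probability.Probability" "HOL-Library.Landau_Symbols"
    "HOL-Computational_Algebra.Primes"
begin

definition dirichlet_character :: "nat \<Rightarrow> (nat \<Rightarrow> complex) \<Rightarrow> bool" where
  "dirichlet_character q chi \<longleftrightarrow>
     (\<forall>m n. chi (m * n) = chi m * chi n) \<and>
     (\<forall>n. chi (n + q) = chi n) \<and>
     (\<forall>n. chi n \<noteq> 0 \<longleftrightarrow> coprime n q) \<and>
     chi 1 = 1"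

text \<open>The n-th prime, 1-indexed: p_1 = 2, p_2 = 3, ...\<close>
definition nth_prime :: "nat \<Rightarrow> nat" where
  "nth_prime n = enumerate {p::nat. prime p} (n - 1)"

text \<open>theta_p: the argument of chi(p), so chi(p) = exp(i theta_p) when p does not divide q.\<close>
definition theta :: "(nat \<Rightarrow> complex) \<Rightarrow> nat \<Rightarrow> real" where
  "theta chi p = Arg (chi p)"

definition B_rand :: "nat \<Rightarrow> (nat \<Rightarrow> complex) \<Rightarrow> (nat \<Rightarrow> nat) \<Rightarrow> real \<Rightarrow> nat \<Rightarrow> real" where
  "B_rand q chi m t N =
     (\<Sum>n \<in> {n \<in> {1..N}. \<not> nth_prime n dvd q}.
        cos (t * ln (real (nth_prime n + m n * q)) - theta chi (nth_prime n)))"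

definition ensemble :: "nat \<Rightarrow> (nat \<Rightarrow> nat) measure" where
  "ensemble M = (\<Pi>\<^sub>M n\<in>UNIV. measure_pmf (pmf_of_set {0..M}))"

definition dirichlet_series :: "(nat \<Rightarrow> complex) \<Rightarrow> complex \<Rightarrow> complex" where
  "dirichlet_series chi s = (\<Sum>n. chi (Suc n) / (of_nat (Suc n)) powr s)"

text \<open>f is the analytic continuation of L(s,chi) to Re s > 0 (minus the possible pole at 1).\<close>
definition L_continuation :: "(nat \<Rightarrow> complex) \<Rightarrow> (complex \<Rightarrow> complex) \<Rightarrow> bool" where
  "L_continuation chi f \<longleftrightarrow>
     f holomorphic_on ({s. Re s > 0} - {1}) \<and>
     (\<forall>s. Re s > 1 \<longrightarrow> f s = dirichlet_series chi s)"

definition RH_dirichlet :: "(nat \<Rightarrow> complex) \<Rightarrow> bool" where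
  "RH_dirichlet chi \<longleftrightarrow>
     (\<forall>f. L_continuation chi f \<longrightarrow>
        (\<forall>s. 0 < Re s \<and> Re s < 1 \<and> f s = 0 \<longrightarrow> Re s = 1/2))"

end

theory Submission
  imports Defs "HOL-Complex_Analysis.Complex_Analysis" "HOL-Number_Theory.Number_Theory"
begin

text \<open>
  At \<open>t = 0\<close> the random shifts drop out, so the hypothesis says that the partial sums of
  \<open>Re (chi p)\<close> over the first \<open>N\<close> primes are \<open>O(N powr (1/2 + \<epsilon>))\<close>. This is impossible for a principal
  character. Otherwise \<open>H(s) = \<Sum>p. 2 Re (chi p) p powr -s\<close> is holomorphic on \<open>Re s > 1/2\<close>, and the
  Euler products give \<open>L(s,chi) L(s,cnj chi) R(s) = exp (H s)\<close>, where \<open>R\<close> is an infinite product that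
  converges for \<open>Re s > 1/2\<close>; so neither \<open>L(s,chi)\<close> nor \<open>L(s,cnj chi)\<close> has a zero there.

  For the left half of the strip, let \<open>chi\<close> be primitive mod \<open>q\<close> with Gauss sum \<open>\<tau>\<close>. The partial
  fractions of the cotangent and the separability of the Gauss sums give
  \<open>\<Sum>k\<in>\<int>. cnj (chi k) / (x - 2\<pi>ik/q) = \<tau> \<Sum>n\<ge>1. chi n exp (-nx)\<close>. Mellin transforms of both sides,
  computed termwise for \<open>0 < Re s < 1\<close> by dominated convergence, express \<open>\<tau> \<Gamma>(s) L(s,chi)\<close> as a
  nonzero multiple of \<open>L(1-s,cnj chi)\<close>. So zeros of \<open>L(s,chi)\<close> reflect to zeros of \<open>L(1-s,cnj chi)\<close>,
  also for imprimitive \<open>chi\<close>, since the additional Euler factors have no zeros with \<open>Re s > 0\<close>.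
\<close>

section \<open>Convergence of Dirichlet series\<close>

text \<open>The hypothesis counts primes by rank, whereas Dirichlet series order them by size. The
  number of primes up to \<open>n\<close> is at most \<open>n\<close>, so the bound carries over
  with the same exponent. In the strip the series for \<open>L(s,chi)\<close> and
  \<open>L(1-s,cnj chi)\<close> converge only conditionally, so the interchanges of limit and
  integral rest on Abel summation: bounded partial character sums are traded for differences of
  smooth weights, which gives majorants uniform in the truncation. Only zeros are reflected: an
  assumed zero annihilates the side of the Mellin identity that carries \<open>\<tau>\<close>,
  whatever the value of \<open>\<tau>\<close>, and the other side is a nonzero constant times the
  reflected L-value. A kernel \<open>1 / (x - i \<alpha>) + \<epsilon> / (x + i \<alpha>)\<close>,
  whose sign \<epsilon> is the value of the character at -1, treats even and odd characters
  together.\<close>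

lemma summation_by_parts:
  fixes a g :: "nat \<Rightarrow> 'a::comm_ring"
  shows "(\<Sum>k<n. a k * g k) = (\<Sum>k<n. a k) * g n + (\<Sum>k<n. (\<Sum>j<Suc k. a j) * (g k - g (Suc k)))"
  by (induction n) (auto simp: algebra_simps)

lemma norm_of_nat_powr: "n > 0 \<Longrightarrow> norm (of_nat n powr s :: complex) = real n powr Re s"
  by (metis norm_powr_real_powr of_nat_0_le_iff of_real_of_nat_eq Reals_of_nat Re_complex_of_real)

text \<open>Mean value inequality on the segment between the two integers: the derivative
  \<open>- s * z powr (- s - 1)\<close> is largest in norm at the left endpoint.\<close>

lemma norm_powr_diff_le:
  fixes s :: complex
  assumes s: "Re s \<ge> 0"
  shows "norm (1 / of_nat (Suc k) powr s - 1 / of_nat (Suc (Suc k)) powr s :: complex)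
           \<le> norm s * real (Suc k) powr (- Re s - 1)"
proof -
  let ?S = "closed_segment (of_nat (Suc k)) (of_nat (Suc (Suc k))) :: complex set"
  let ?f = "\<lambda>z::complex. z powr (-s)"
  have S: "\<exists>x. z = of_real x \<and> x \<ge> real (Suc k)" if "z \<in> ?S" for z
  proof -
    have "?S = of_real ` closed_segment (real (Suc k)) (real (Suc (Suc k)))"
      by (simp flip: closed_segment_of_real add: closed_segment_of_real[of "real (Suc k)" "real (Suc (Suc k))", simplified])
    with that show ?thesis
      by (auto simp: closed_segment_eq_real_ivl)
  qed
  have "norm (?f (of_nat (Suc (Suc k))) - ?f (of_nat (Suc k)))
          \<le> (norm s * real (Suc k) powr (- Re s - 1)) * norm (of_nat (Suc (Suc k)) - of_nat (Suc k) :: complex)"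
  proof (rule field_differentiable_bound[where S = ?S])
    fix z assume "z \<in> ?S"
    then obtain x where x: "z = of_real x" "x \<ge> real (Suc k)" using S by blast
    have "x > 0" using x by linarith
    then have "z \<notin> \<real>\<^sub>\<le>\<^sub>0" using x by simp
    then show "(?f has_field_derivative (- s * z powr (- s - 1))) (at z within ?S)"
      by (auto intro!: derivative_eq_intros)
    have "norm (z powr (- s - 1)) = x powr (- Re s - 1)"
      using \<open>x > 0\<close> x by (simp add: norm_powr_real_powr)
    also have "\<dots> \<le> real (Suc k) powr (- Re s - 1)"
      using x s by (intro powr_mono2') auto
    finally show "norm (- s * z powr (- s - 1)) \<le> norm s * real (Suc k) powr (- Re s - 1)"
      by (simp add: norm_mult mult_left_mono)
  qed auto
  then show ?thesis
    by (simp add: powr_minus_divide norm_minus_commute)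
qed


text \<open>Abel summation: the boundary term is of order \<open>n powr (-\<delta>)\<close> and the
  k-th difference term of order \<open>k powr (-1 - \<delta>)\<close>, so the Weierstrass test
  applies. The differences carry a factor \<open>norm s\<close>, whence the boundedness of
  \<open>X\<close>.\<close>

lemma dirichlet_series_uniform_limit:
  fixes a :: "nat \<Rightarrow> complex"
  assumes A: "\<And>n. norm (\<Sum>k<n. a (Suc k)) \<le> C * real n powr \<theta>" and \<theta>: "\<theta> \<ge> 0"
    and X: "bounded X" and \<delta>: "\<delta> > 0" "\<And>s. s \<in> X \<Longrightarrow> Re s \<ge> \<theta> + \<delta>"
  shows "uniform_limit X (\<lambda>n s. \<Sum>k<n. a (Suc k) / of_nat (Suc k) powr s) (dirichlet_series a) sequentially"
proof -
  define S where "S = (\<lambda>n. \<Sum>k<n. a (Suc k))"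
  define g :: "nat \<Rightarrow> complex \<Rightarrow> complex" where "g = (\<lambda>k s. 1 / of_nat (Suc k) powr s)"
  obtain B where B: "B > 0" "\<And>s. s \<in> X \<Longrightarrow> norm s \<le> B"
    using X unfolding bounded_pos by blast
  have C: "C \<ge> 0"
    using order_trans[OF norm_ge_zero A[of 1]] by simp
  have Re0: "Re s \<ge> 0" if "s \<in> X" for s
    using \<delta>(2)[OF that] \<delta>(1) \<theta> by linarith
  have S: "norm (S n) \<le> C * real (Suc n) powr \<theta>" for n
  proof -
    have "real n powr \<theta> \<le> real (Suc n) powr \<theta>"
      using \<theta> by (intro powr_mono2) auto
    then show ?thesis
      using A[of n] C unfolding S_def by (meson mult_left_mono order_trans)
  qed
  have by_parts: "(\<Sum>k<n. a (Suc k) / of_nat (Suc k) powr s)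
      = S n * g n s + (\<Sum>k<n. S (Suc k) * (g k s - g (Suc k) s))" for n s
    using summation_by_parts[of "\<lambda>k. a (Suc k)" "\<lambda>k. g k s" n] by (simp add: S_def g_def)
  have "uniformly_convergent_on X (\<lambda>n s. \<Sum>k<n. S (Suc k) * (g k s - g (Suc k) s))"
  proof (rule Weierstrass_m_test')
    fix k s assume s: "s \<in> X"
    have "norm (S (Suc k)) \<le> C * real (Suc k) powr \<theta>"
      using A[of "Suc k"] by (simp add: S_def)
    moreover have "norm (g k s - g (Suc k) s) \<le> B * real (Suc k) powr (- \<theta> - \<delta> - 1)"
    proof -
      have "norm (g k s - g (Suc k) s) \<le> norm s * real (Suc k) powr (- Re s - 1)"
        unfolding g_def using Re0[OF s] by (rule norm_powr_diff_le)
      also have "\<dots> \<le> B * real (Suc k) powr (- \<theta> - \<delta> - 1)"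
        using B s \<delta>(2)[OF s] by (intro mult_mono powr_mono) auto
      finally show ?thesis .
    qed
    ultimately have "norm (S (Suc k)) * norm (g k s - g (Suc k) s)
        \<le> (C * real (Suc k) powr \<theta>) * (B * real (Suc k) powr (- \<theta> - \<delta> - 1))"
      by (intro mult_mono) (use C in auto)
    also have "\<dots> = C * B * (real (Suc k) powr \<theta> * real (Suc k) powr (- \<theta> - \<delta> - 1))"
      by simp
    also have "real (Suc k) powr \<theta> * real (Suc k) powr (- \<theta> - \<delta> - 1) = real (Suc k) powr (-1 - \<delta>)"
      by (simp flip: powr_add add: algebra_simps)
    finally show "norm (S (Suc k) * (g k s - g (Suc k) s)) \<le> C * B * real (Suc k) powr (-1 - \<delta>)"
      by (simp add: norm_mult)
  next
    have "summable (\<lambda>k. real k powr (-1 - \<delta>))"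
      using \<delta> by (simp add: summable_real_powr_iff)
    then have "summable (\<lambda>k. real (Suc k) powr (-1 - \<delta>))"
      by (subst summable_Suc_iff)
    then show "summable (\<lambda>k. C * B * real (Suc k) powr (-1 - \<delta>))"
      by (rule summable_mult)
  qed
  then obtain l where l: "uniform_limit X (\<lambda>n s. \<Sum>k<n. S (Suc k) * (g k s - g (Suc k) s)) l sequentially"
    unfolding uniformly_convergent_on_def by blast
  have "uniform_limit X (\<lambda>n s. S n * g n s) (\<lambda>_. 0) sequentially"
  proof (rule uniform_limitI)
    fix e :: real assume e: "e > 0"
    have "(\<lambda>n. C * real (Suc n) powr (-\<delta>)) \<longlonglongrightarrow> C * 0"
      using \<delta>(1) by (intro tendsto_mult tendsto_const tendsto_neg_powr) (auto intro: filterlim_compose[OF filterlim_real_sequentially filterlim_Suc] simp del: of_nat_Suc)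
    then have "eventually (\<lambda>n. C * real (Suc n) powr (-\<delta>) < e) sequentially"
      using e by (simp add: order_tendstoD(2))
    then show "\<forall>\<^sub>F n in sequentially. \<forall>s\<in>X. dist (S n * g n s) 0 < e"
    proof eventually_elim
      case (elim n)
      show ?case
      proof
        fix s assume s: "s \<in> X"
        have "norm (S n * g n s) \<le> (C * real (Suc n) powr \<theta>) * real (Suc n) powr (- Re s)"
          unfolding norm_mult
          by (intro mult_mono S)
             (use C in \<open>auto simp: g_def norm_divide norm_of_nat_powr powr_minus_divide simp del: of_nat_Suc\<close>)
        also have "\<dots> = C * real (Suc n) powr (\<theta> - Re s)"
          by (simp add: powr_add[symmetric])
        also have "\<dots> \<le> C * real (Suc n) powr (-\<delta>)"
          using \<delta>(2)[OF s] C by (intro mult_left_mono powr_mono) auto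
        finally show "dist (S n * g n s) 0 < e" using elim by simp
      qed
    qed
  qed
  from uniform_limit_add[OF this l]
  have lim: "uniform_limit X (\<lambda>n s. \<Sum>k<n. a (Suc k) / of_nat (Suc k) powr s) l sequentially"
    by (simp add: by_parts del: of_nat_Suc)
  have "dirichlet_series a s = l s" if "s \<in> X" for s
    unfolding dirichlet_series_def
    using tendsto_uniform_limitI[OF lim that] by (intro sums_unique[symmetric]) (simp add: sums_def)
  then show ?thesis
    by (intro uniform_limit_cong'[THEN iffD1, OF _ _ lim]) auto
qed

lemma dirichlet_series_sums:
  assumes "\<And>n. norm (\<Sum>k<n. a (Suc k)) \<le> C * real n powr \<theta>" and "\<theta> \<ge> 0" and "Re s > \<theta>"
  shows "(\<lambda>n. a (Suc n) / of_nat (Suc n) powr s) sums dirichlet_series a s"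
  using tendsto_uniform_limitI[OF dirichlet_series_uniform_limit[OF assms(1,2), where X="{s}" and \<delta>="Re s - \<theta>"]] assms(3)
  by (simp add: sums_def)

lemma dirichlet_series_holomorphic:
  assumes "\<And>n. norm (\<Sum>k<n. a (Suc k)) \<le> C * real n powr \<theta>" and "\<theta> \<ge> 0"
  shows "dirichlet_series a holomorphic_on {s. Re s > \<theta>}"
proof (rule holomorphic_uniform_sequence)
  show "open {s. Re s > \<theta>}" by (rule open_halfspace_Re_gt)
  show "(\<lambda>s. \<Sum>k<n. a (Suc k) / of_nat (Suc k) powr s) holomorphic_on {s. Re s > \<theta>}" for n
    by (intro holomorphic_intros) (auto simp del: of_nat_Suc)
next
  fix x assume "x \<in> {s. Re s > \<theta>}"
  then have x: "Re x > \<theta>" by simp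
  define d where "d = (Re x - \<theta>) / 2"
  have d: "d > 0" using x by (simp add: d_def)
  have *: "Re s \<ge> \<theta> + d" if "s \<in> cball x d" for s
  proof -
    have "\<bar>Re (x - s)\<bar> \<le> d"
      using that abs_Re_le_cmod[of "x - s"] by (simp add: dist_norm)
    then have "Re x - Re s \<le> d" by (simp add: abs_le_iff)
    then show ?thesis by (simp add: d_def field_simps)
  qed
  show "\<exists>d>0. cball x d \<subseteq> {s. Re s > \<theta>} \<and>
      uniform_limit (cball x d) (\<lambda>n s. \<Sum>k<n. a (Suc k) / of_nat (Suc k) powr s) (dirichlet_series a) sequentially"
  proof (intro exI[of _ d] conjI)
    show "cball x d \<subseteq> {s. Re s > \<theta>}" using * d by fastforce
    show "uniform_limit (cball x d) (\<lambda>n s. \<Sum>k<n. a (Suc k) / of_nat (Suc k) powr s) (dirichlet_series a) sequentially"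
      by (rule dirichlet_series_uniform_limit[OF assms bounded_cball d]) (rule *)
  qed (rule d)
qed

section \<open>Euler products\<close>

lemma has_sum_uminusI: "(f has_sum (a::complex)) A \<Longrightarrow> ((\<lambda>x. - f x) has_sum - a) A"
  using has_sum_uminus[of f A "-a"] by simp

text \<open>Unordered summation over the positive integers, so that the sieve below may reindex
  along multiples of a prime.\<close>

lemma dirichlet_series_has_sum:
  fixes a :: "nat \<Rightarrow> complex"
  assumes a: "\<And>n. norm (a n) \<le> 1" and s: "Re s > 1"
  shows "((\<lambda>n. a n / of_nat n powr s) has_sum dirichlet_series a s) {0<..}"
proof -
  let ?f = "\<lambda>n. a (Suc n) / of_nat (Suc n) powr s"
  have "summable (\<lambda>n. norm (?f n))"
  proof (rule summable_comparison_test)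
    show "summable (\<lambda>n. real (Suc n) powr (- Re s))"
      using s by (subst summable_Suc_iff) (simp add: summable_real_powr_iff)
    show "\<exists>N. \<forall>n\<ge>N. norm (norm (?f n)) \<le> real (Suc n) powr (- Re s)"
      using a by (auto simp: norm_divide norm_of_nat_powr powr_minus_divide divide_right_mono simp del: of_nat_Suc)
  qed
  then have "(?f has_sum dirichlet_series a s) UNIV"
    unfolding dirichlet_series_def
    by (intro norm_summable_imp_has_sum summable_sums) (auto intro: summable_norm_cancel)
  moreover have "bij_betw Suc UNIV {0<..}"
    by (rule bij_betwI[of _ _ _ "\<lambda>n. n - 1"]) auto
  ultimately show ?thesis
    by (subst has_sum_reindex_bij_betw[of Suc UNIV, symmetric]) (auto simp del: of_nat_Suc)
qed

text \<open>One prime at a time: in the series already sieved by \<open>P\<close>, the terms at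
  multiples of a new prime \<open>p\<close> add up to \<open>a p / p powr s\<close> times that same
  series, by complete multiplicativity. Removing them contributes one Euler factor.\<close>

lemma dirichlet_series_sieve:
  fixes a :: "nat \<Rightarrow> complex"
  assumes mult: "\<And>m n. a (m * n) = a m * a n" and a: "\<And>n. norm (a n) \<le> 1" and s: "Re s > 1"
    and "finite P" "\<And>p. p \<in> P \<Longrightarrow> prime p"
  shows "dirichlet_series (\<lambda>n. if \<exists>p\<in>P. p dvd n then 0 else a n) s
           = (\<Prod>p\<in>P. 1 - a p / of_nat p powr s) * dirichlet_series a s"
  using assms(4,5)
proof (induction P rule: finite_induct)
  case empty
  show ?case by simp
next
  case (insert p P)
  define b where "b = (\<lambda>n. if \<exists>p\<in>P. p dvd n then 0 else a n)"
  define c where "c = (\<lambda>n. if \<exists>p\<in>insert p P. p dvd n then 0 else a n)"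
  have p: "prime p" using insert by auto
  have b: "norm (b n) \<le> 1" and c: "norm (c n) \<le> 1" for n
    using a by (auto simp: b_def c_def)
  have bp: "b (p * n) = a p * b n" for n
  proof -
    have "(\<exists>r\<in>P. r dvd p * n) = (\<exists>r\<in>P. r dvd n)"
    proof (intro bex_cong refl)
      fix r assume "r \<in> P"
      then have "prime r" "r \<noteq> p" using insert by auto
      then have "\<not> r dvd p" using p primes_dvd_imp_eq by blast
      then show "(r dvd p * n) = (r dvd n)" using \<open>prime r\<close> by (simp add: prime_dvd_mult_iff)
    qed
    then show ?thesis by (simp add: b_def mult)
  qed
  have "((\<lambda>n. b n / of_nat n powr s - c n / of_nat n powr s) has_sum (dirichlet_series b s - dirichlet_series c s)) {0<..}"
    using has_sum_add[OF dirichlet_series_has_sum[of b, OF b s] has_sum_uminusI[OF dirichlet_series_has_sum[of c, OF c s]]]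
    by simp
  moreover have "((\<lambda>n. b n / of_nat n powr s - c n / of_nat n powr s) has_sum (a p / of_nat p powr s * dirichlet_series b s)) {0<..}"
  proof -
    have "((\<lambda>n. a p / of_nat p powr s * (b n / of_nat n powr s)) has_sum (a p / of_nat p powr s * dirichlet_series b s)) {0<..}"
      by (intro has_sum_cmult_right dirichlet_series_has_sum b s)
    also have "?this \<longleftrightarrow> ((\<lambda>n. b (p * n) / of_nat (p * n) powr s) has_sum (a p / of_nat p powr s * dirichlet_series b s)) {0<..}"
      by (intro has_sum_cong) (simp add: bp powr_times_real)
    also have "\<dots> \<longleftrightarrow> ((\<lambda>n. b n / of_nat n powr s) has_sum (a p / of_nat p powr s * dirichlet_series b s)) ((*) p ` {0<..})"
      using p by (subst has_sum_reindex) (auto simp: inj_on_def o_def)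
    also have "\<dots> \<longleftrightarrow> ((\<lambda>n. b n / of_nat n powr s - c n / of_nat n powr s) has_sum (a p / of_nat p powr s * dirichlet_series b s)) {0<..}"
    proof (intro has_sum_cong_neutral)
      fix x assume "x \<in> {0<..} - (*) p ` {0<..}"
      then have "\<not> p dvd x" by (auto elim!: dvdE)
      then show "b x / of_nat x powr s - c x / of_nat x powr s = 0" by (auto simp: b_def c_def)
    next
      fix x assume "x \<in> (*) p ` {0<..} - {0<..}"
      then show "b x / of_nat x powr s = 0" using p by (auto simp: prime_gt_0_nat)
    next
      fix x assume "x \<in> (*) p ` {0<..} \<inter> {0<..}"
      then show "b x / of_nat x powr s = b x / of_nat x powr s - c x / of_nat x powr s"
        by (auto simp: c_def)
    qed
    finally show ?thesis .
  qed
  ultimately have "dirichlet_series b s - dirichlet_series c s = a p / of_nat p powr s * dirichlet_series b s"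
    by (rule has_sum_unique)
  then have "dirichlet_series c s = (1 - a p / of_nat p powr s) * dirichlet_series b s"
    by (simp add: algebra_simps)
  also have "dirichlet_series b s = (\<Prod>p\<in>P. 1 - a p / of_nat p powr s) * dirichlet_series a s"
    using insert unfolding b_def by auto
  finally show ?case using insert unfolding c_def by (simp add: mult.assoc)
qed

lemma norm_divide_powr_less_1:
  assumes "norm (c::complex) \<le> 1" "p \<ge> 2" "Re s > 0"
  shows "norm (c / of_nat p powr s) < 1"
proof -
  have "1 < real p powr Re s"
    using assms by (intro gr_one_powr) auto
  then show ?thesis
    using assms order.strict_trans1[of "norm c" 1 "real p powr Re s"] by (simp add: norm_divide norm_of_nat_powr)
qed

text \<open>Each \<open>n > 1\<close> has a prime factor and is eventually sieved out, so only the
  term 1 survives; the majorant \<open>n powr (- Re s)\<close> makes this limit uniform enough for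
  Tannery's theorem. Together with the sieve identity this is the Euler product in the form "finite
  product times L-value tends to 1".\<close>

lemma dirichlet_series_sieve_tendsto:
  fixes a :: "nat \<Rightarrow> complex"
  assumes a: "\<And>n. norm (a n) \<le> 1" "a 1 = 1" and s: "Re s > 1"
  shows "(\<lambda>N. dirichlet_series (\<lambda>n. if \<exists>p\<in>{p. prime p \<and> p < N}. p dvd n then 0 else a n) s) \<longlonglongrightarrow> 1"
proof -
  define b where "b = (\<lambda>N n. if \<exists>p\<in>{p. prime p \<and> p < N}. p dvd n then 0 else a n)"
  define g where "g = (\<lambda>n. real (Suc n) powr (- Re s))"
  have g: "summable g"
    unfolding g_def using s by (subst summable_Suc_iff) (simp add: summable_real_powr_iff)
  have ub: "norm (b N (Suc n) / of_nat (Suc n) powr s) \<le> g n" for N n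
    using a by (auto simp: b_def g_def norm_divide norm_of_nat_powr powr_minus_divide divide_right_mono simp del: of_nat_Suc)
  have ptw: "(\<lambda>N. b N (Suc n) / of_nat (Suc n) powr s) \<longlonglongrightarrow> (if n = 0 then 1 else 0)" for n
  proof (cases "n = 0")
    case True
    then show ?thesis using a by (auto simp: b_def)
  next
    case False
    then obtain p where p: "prime p" "p dvd Suc n" using prime_factor_nat[of "Suc n"] by auto
    have "eventually (\<lambda>N. b N (Suc n) / of_nat (Suc n) powr s = 0) sequentially"
      using eventually_gt_at_top[of p] by eventually_elim (use p in \<open>auto simp: b_def\<close>)
    then show ?thesis using False by (simp add: tendsto_eventually)
  qed
  have "(\<lambda>N. \<Sum>n. b N (Suc n) / of_nat (Suc n) powr s) \<longlonglongrightarrow> (\<Sum>n. if n = 0 then 1 else 0)"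
    using tannerys_theorem[of "\<lambda>n N. b N (Suc n) / of_nat (Suc n) powr s", OF ptw _ g] ub
    by (simp add: case_prod_unfold del: of_nat_Suc)
  moreover have "(\<Sum>n::nat. if n = 0 then 1 else 0 :: complex) = 1"
    using sums_single[of 0 "\<lambda>_. 1 :: complex"] by (simp add: sums_iff)
  ultimately show ?thesis
    by (simp add: dirichlet_series_def b_def)
qed

section \<open>Dirichlet characters\<close>

lemma dirichlet_character_mult: "dirichlet_character q chi \<Longrightarrow> chi (m * n) = chi m * chi n"
  and dirichlet_character_1: "dirichlet_character q chi \<Longrightarrow> chi (Suc 0) = 1"
  and dirichlet_character_eq_0_iff: "dirichlet_character q chi \<Longrightarrow> chi n = 0 \<longleftrightarrow> \<not> coprime n q"
  by (auto simp: dirichlet_character_def)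

lemma dirichlet_character_add_mult:
  assumes "dirichlet_character q chi"
  shows "chi (n + k * q) = chi n"
proof (induction k)
  case (Suc k)
  have "n + Suc k * q = (n + k * q) + q" by (simp add: algebra_simps)
  then show ?case using assms Suc unfolding dirichlet_character_def by metis
qed auto

lemma dirichlet_character_mod: "dirichlet_character q chi \<Longrightarrow> chi (n mod q) = chi n"
  by (metis dirichlet_character_add_mult div_mult_mod_eq add.commute)

lemma dirichlet_character_cong: "dirichlet_character q chi \<Longrightarrow> [m = n] (mod q) \<Longrightarrow> chi m = chi n"
  by (metis cong_def dirichlet_character_mod)

lemma dirichlet_character_power:
  assumes "dirichlet_character q chi"
  shows "chi (n ^ k) = chi n ^ k"
  by (induction k) (auto simp: dirichlet_character_mult[OF assms] dirichlet_character_1[OF assms])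

text \<open>By Euler's theorem \<open>chi n ^ totient q = 1\<close>, so the value is a root of
  unity.\<close>

lemma dirichlet_character_norm:
  assumes chi: "dirichlet_character q chi" and q: "q > 0" and n: "coprime n q"
  shows "norm (chi n) = 1"
proof -
  have "chi n ^ totient q = 1"
    using dirichlet_character_cong[OF chi euler_theorem[OF n]] dirichlet_character_1[OF chi]
    by (simp add: dirichlet_character_power[OF chi])
  then have "norm (chi n) ^ totient q = 1"
    by (metis norm_power norm_one)
  then show ?thesis
    using q power_eq_imp_eq_base[of "norm (chi n)" "totient q" 1] by simp
qed

lemma dirichlet_character_norm_le:
  assumes "dirichlet_character q chi" "q > 0"
  shows "norm (chi n) \<le> 1"
  using dirichlet_character_norm[OF assms, of n] dirichlet_character_eq_0_iff[OF assms(1), of n]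
  by (cases "coprime n q") auto

lemma dirichlet_character_cnj:
  "dirichlet_character q chi \<Longrightarrow> dirichlet_character q (\<lambda>n. cnj (chi n))"
  by (simp add: dirichlet_character_def)

lemma bij_betw_mult_mod:
  fixes a q :: nat
  assumes "coprime a q" "q > 0"
  shows "bij_betw (\<lambda>r. (a * r) mod q) {..<q} {..<q}"
proof -
  have "inj_on (\<lambda>r. (a * r) mod q) {..<q}"
  proof (rule inj_onI)
    fix x y assume *: "x \<in> {..<q}" "y \<in> {..<q}" "(a * x) mod q = (a * y) mod q"
    then have "[a * x = a * y] (mod q)" by (simp add: cong_def)
    then have "[x = y] (mod q)" using assms by (simp add: cong_mult_lcancel_nat)
    then show "x = y" using * by (simp add: cong_def)
  qed
  moreover have "(\<lambda>r. (a * r) mod q) ` {..<q} \<subseteq> {..<q}" using assms by auto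
  ultimately show ?thesis
    by (simp add: bij_betw_def endo_inj_surj)
qed

text \<open>Multiplication by the unit \<open>a\<close> permutes the residues and multiplies the sum
  by \<open>chi a\<close>, which differs from 1.\<close>

lemma dirichlet_character_sum_eq_0:
  assumes chi: "dirichlet_character q chi" and q: "q > 0" and a: "coprime a q" "chi a \<noteq> 1"
  shows "(\<Sum>r<q. chi r) = 0"
proof -
  have "(\<Sum>r<q. chi r) = (\<Sum>r<q. chi ((a * r) mod q))"
    by (rule sum.reindex_bij_betw[OF bij_betw_mult_mod[OF a(1) q], symmetric])
  also have "\<dots> = chi a * (\<Sum>r<q. chi r)"
    by (simp add: dirichlet_character_mod[OF chi] dirichlet_character_mult[OF chi] sum_distrib_left)
  finally show ?thesis using a(2) by (metis mult_cancel_right1)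
qed

text \<open>Complete periods cancel, which leaves \<open>n mod q\<close> terms of norm at most
  1.\<close>

lemma periodic_sum_bounded:
  fixes f :: "nat \<Rightarrow> complex"
  assumes per: "\<And>n. f (n + q) = f n" and sum0: "(\<Sum>k<q. f k) = 0" and f: "\<And>n. norm (f n) \<le> 1" and q: "q > 0"
  shows "norm (\<Sum>k<n. f k) \<le> real q"
proof -
  have per': "f (n + k * q) = f n" for n k
  proof (induction k)
    case (Suc k)
    have "n + Suc k * q = (n + k * q) + q" by (simp add: algebra_simps)
    then show ?case using Suc per by metis
  qed auto
  have split: "(\<Sum>k<j * q + i. f k) = (\<Sum>k<j * q. f k) + (\<Sum>k<i. f (k + j * q))" for i j
    by (induction i) (auto simp: algebra_simps)
  have "(\<Sum>k<j * q. f k) = 0" for j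
  proof (induction j)
    case (Suc j)
    have "(\<Sum>k<Suc j * q. f k) = (\<Sum>k<j * q + q. f k)" by (simp add: add.commute)
    also have "\<dots> = (\<Sum>k<j * q. f k) + (\<Sum>k<q. f (k + j * q))"
      by (rule split)
    finally show ?case using Suc sum0 per' by simp
  qed auto
  then have "(\<Sum>k<j * q + i. f k) = (\<Sum>k<i. f k)" for i j
    using per' by (simp add: split)
  from this[of "n div q" "n mod q"] have "(\<Sum>k<n. f k) = (\<Sum>k<n mod q. f k)" by simp
  also have "norm \<dots> \<le> (\<Sum>k<n mod q. 1)"
    by (intro sum_norm_le f)
  also have "\<dots> \<le> real q" using q by (simp add: less_imp_le)
  finally show ?thesis .
qed

lemma dirichlet_character_sum_Suc_eq_0:
  assumes chi: "dirichlet_character q chi" and q: "q > 0" and a: "coprime a q" "chi a \<noteq> 1"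
  shows "(\<Sum>r<q. chi (Suc r)) = 0"
proof -
  have "(\<Sum>r<q. chi (Suc r)) + chi 0 = (\<Sum>r<Suc q. chi r)"
    by (subst sum.lessThan_Suc_shift) simp
  also have "\<dots> = chi q" using dirichlet_character_sum_eq_0[OF assms] by simp
  also have "chi q = chi 0" using dirichlet_character_mod[OF chi, of q] by simp
  finally show ?thesis by simp
qed

text \<open>The factor \<open>real n powr 0\<close> puts the bound in the form required by the
  convergence lemmas with exponent 0. As \<open>0 powr 0 = 0\<close>, the case \<open>n = 0\<close>
  is separate and holds because the sum is empty.\<close>

lemma dirichlet_character_partial_sum:
  assumes chi: "dirichlet_character q chi" and q: "q > 0" and a: "coprime a q" "chi a \<noteq> 1"
  shows "norm (\<Sum>k<n. chi (Suc k)) \<le> real q * real n powr 0"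
proof (cases "n = 0")
  case False
  have "norm (\<Sum>k<n. chi (Suc k)) \<le> real q"
  proof (rule periodic_sum_bounded[OF _ dirichlet_character_sum_Suc_eq_0[OF assms] _ q])
    show "chi (Suc (m + q)) = chi (Suc m)" for m
      using dirichlet_character_add_mult[OF chi, of "Suc m" 1] by simp
  qed (rule dirichlet_character_norm_le[OF chi q])
  then show ?thesis using False by simp
qed auto

lemma dirichlet_L_sums:
  assumes "dirichlet_character q chi" "q > 0" "coprime a q" "chi a \<noteq> 1" and "Re s > 0"
  shows "(\<lambda>n. chi (Suc n) / of_nat (Suc n) powr s) sums dirichlet_series chi s"
  using dirichlet_series_sums[OF dirichlet_character_partial_sum[OF assms(1-4)]] assms(5) by simp

lemma dirichlet_L_holomorphic:
  assumes "dirichlet_character q chi" "q > 0" "coprime a q" "chi a \<noteq> 1"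
  shows "dirichlet_series chi holomorphic_on {s. Re s > 0}"
  using dirichlet_series_holomorphic[OF dirichlet_character_partial_sum[OF assms]] by simp

section \<open>Non-vanishing to the right of the critical line\<close>

text \<open>The derivative of \<open>(1 - w) * exp w\<close> is \<open>- w * exp w\<close>, which
  vanishes at 0; integrating it over the segment from 0 produces the square. The constant 3 bounds
  \<open>exp 1\<close>.\<close>

lemma one_minus_times_exp_bound:
  fixes w :: complex
  assumes w: "norm w \<le> 1"
  shows "norm ((1 - w) * exp w - 1) \<le> 3 * norm w ^ 2"
proof -
  have "norm ((1 - w) * exp w - (1 - 0) * exp 0) \<le> (3 * norm w) * norm (w - 0)"
  proof (rule field_differentiable_bound[where S = "closed_segment 0 w"])
    fix z assume z: "z \<in> closed_segment 0 w"
    then have zw: "norm z \<le> norm w"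
      using segment_bound1[of z 0 w] by simp
    show "((\<lambda>w. (1 - w) * exp w) has_field_derivative (- z * exp z)) (at z within closed_segment 0 w)"
      by (auto intro!: derivative_eq_intros simp: algebra_simps)
    have "norm (exp z) \<le> exp (norm z)" by (rule norm_exp)
    also have "\<dots> \<le> exp 1" using zw w by simp
    also have "\<dots> \<le> 3" by (rule exp_le)
    finally show "norm (- z * exp z) \<le> 3 * norm w"
      using zw by (simp add: norm_mult mult_mono mult.commute[of 3])
  qed auto
  then show ?thesis by (simp add: power2_eq_square)
qed

text \<open>The exponential cancels the linear term of the Euler factor, so each factor differs from
  1 by at most \<open>3 * n powr (- 2 * Re s)\<close>, which is summable exactly when
  \<open>Re s > 1/2\<close>. Holomorphy of \<open>R\<close> is what matters later: a cofactor
  without poles cannot cancel a zero of the L-function.\<close>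

lemma regularized_euler_product:
  fixes a :: "nat \<Rightarrow> complex"
  assumes a: "\<And>n. norm (a n) \<le> 1"
  obtains R where "R holomorphic_on {s. Re s > 1/2}"
    "\<And>s. Re s > 1/2 \<Longrightarrow> (\<lambda>N. \<Prod>n<N. if prime n then (1 - a n / of_nat n powr s) * exp (a n / of_nat n powr s) else 1) \<longlonglongrightarrow> R s"
proof -
  define E where "E = (\<lambda>n s. if prime n then (1 - a n / of_nat n powr s) * exp (a n / of_nat n powr s) else 1)"
  define U where "U = {s::complex. Re s > 1/2}"
  define R where "R = (\<lambda>s. lim (\<lambda>N. \<Prod>n<N. E n s))"
  have hol: "E n holomorphic_on U" for n
    unfolding E_def by (cases "prime n") (auto intro!: holomorphic_intros simp: prime_gt_0_nat)
  have ulim: "\<exists>d>0. cball x d \<subseteq> U \<and> uniform_limit (cball x d) (\<lambda>N s. \<Prod>n<N. E n s) R sequentially"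
    if "x \<in> U" for x
  proof -
    define d where "d = (Re x - 1/2) / 2"
    have d: "d > 0" using that by (simp add: d_def U_def)
    have *: "Re s \<ge> 1/2 + d" if "s \<in> cball x d" for s
    proof -
      have "\<bar>Re (x - s)\<bar> \<le> d"
        using that abs_Re_le_cmod[of "x - s"] by (simp add: dist_norm)
      then have "Re x - Re s \<le> d" by (simp add: abs_le_iff)
      then show ?thesis by (simp add: d_def field_simps)
    qed
    have sub: "cball x d \<subseteq> U" using * d by (force simp: U_def)
    have "uniformly_convergent_on (cball x d) (\<lambda>N s. \<Prod>n<N. E n s)"
    proof (rule uniformly_convergent_on_prod')
      show "continuous_on (cball x d) (E n)" for n
        using holomorphic_on_imp_continuous_on[OF hol] sub continuous_on_subset by blast
      show "uniformly_convergent_on (cball x d) (\<lambda>N s. \<Sum>n<N. norm (E n s - 1))"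
      proof (rule Weierstrass_m_test')
        fix n s assume s: "s \<in> cball x d"
        show "norm (norm (E n s - 1)) \<le> 3 * real n powr (-1 - 2 * d)"
        proof (cases "prime n")
          case True
          define w where "w = a n / of_nat n powr s"
          have n: "n \<ge> 2" using True by (rule prime_ge_2_nat)
          have "norm w \<le> 1"
            using norm_divide_powr_less_1[OF a n, of s n] *[OF s] d by (simp add: w_def)
          then have "norm (E n s - 1) \<le> 3 * norm w ^ 2"
            using one_minus_times_exp_bound[of w] True by (simp add: E_def w_def)
          also have "norm w \<le> real n powr (- Re s)"
            using a n by (simp add: w_def norm_divide norm_of_nat_powr powr_minus_divide divide_right_mono)
          then have "norm w ^ 2 \<le> (real n powr (- Re s)) ^ 2"
            by (intro power_mono) auto
          also have "\<dots> = real n powr (- 2 * Re s)"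
            using n by (simp add: powr_power)
          also have "\<dots> \<le> real n powr (-1 - 2 * d)"
            using n *[OF s] by (intro powr_mono) auto
          finally show ?thesis by simp
        qed (simp add: E_def)
      next
        show "summable (\<lambda>n. 3 * real n powr (-1 - 2 * d))"
          using d by (intro summable_mult) (simp add: summable_real_powr_iff)
      qed
    qed auto
    then have "uniform_limit (cball x d) (\<lambda>N s. \<Prod>n<N. E n s) R sequentially"
      unfolding R_def by (simp add: uniformly_convergent_uniform_limit_iff)
    then show ?thesis using d sub by blast
  qed
  show ?thesis
  proof (rule that)
    show "R holomorphic_on {s. Re s > 1/2}"
      unfolding U_def[symmetric]
    proof (rule holomorphic_uniform_sequence[OF _ _ ulim])
      show "open U" unfolding U_def by (rule open_halfspace_Re_gt)
    qed (intro holomorphic_on_prod hol)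
    fix s :: complex assume "Re s > 1/2"
    then obtain d where "d > 0" "uniform_limit (cball s d) (\<lambda>N s. \<Prod>n<N. E n s) R sequentially"
      using ulim[of s] by (auto simp: U_def)
    then have "(\<lambda>N. \<Prod>n<N. E n s) \<longlonglongrightarrow> R s"
      by (intro tendsto_uniform_limitI[where S = "cball s d"]) auto
    then show "(\<lambda>N. \<Prod>n<N. if prime n then (1 - a n / of_nat n powr s) * exp (a n / of_nat n powr s) else 1) \<longlonglongrightarrow> R s"
      by (simp add: E_def)
  qed
qed

lemma dirichlet_series_sums_gt_1:
  fixes a :: "nat \<Rightarrow> complex"
  assumes "\<And>n. norm (a n) \<le> 1" "Re s > 1"
  shows "(\<lambda>n. a (Suc n) / of_nat (Suc n) powr s) sums dirichlet_series a s"
proof -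
  have "((\<lambda>n. a (Suc n) / of_nat (Suc n) powr s) has_sum dirichlet_series a s) UNIV"
  proof (subst has_sum_reindex_bij_betw[of Suc UNIV "{0<..}" "\<lambda>n. a n / of_nat n powr s"])
    show "bij_betw Suc UNIV {0<..}"
      by (rule bij_betwI[of _ _ _ "\<lambda>n. n - 1"]) auto
    show "((\<lambda>n. a n / of_nat n powr s) has_sum dirichlet_series a s) {0<..}"
      by (rule dirichlet_series_has_sum[of a s, OF assms])
  qed
  then show ?thesis by (rule has_sum_imp_sums)
qed

text \<open>Up to \<open>N\<close> the regularized product is the sieve product times the
  exponential of a partial sum over primes. Multiplied by the L-value, the sieve product tends to 1;
  two evaluations of one limit then give the identity without any division by the L-value.\<close>

lemma dirichlet_series_times_euler_product:
  fixes a :: "nat \<Rightarrow> complex"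
  assumes mult: "\<And>m n. a (m * n) = a m * a n" and a: "\<And>n. norm (a n) \<le> 1" "a 1 = 1" and s: "Re s > 1"
    and R: "(\<lambda>N. \<Prod>n<N. if prime n then (1 - a n / of_nat n powr s) * exp (a n / of_nat n powr s) else 1) \<longlonglongrightarrow> R"
  shows "dirichlet_series a s * R = exp (dirichlet_series (\<lambda>n. if prime n then a n else 0) s)"
proof -
  define w where "w = (\<lambda>n. a n / of_nat n powr s)"
  define b where "b = (\<lambda>n. if prime n then a n else 0)"
  have prod_eq: "(\<Prod>n<N. if prime n then (1 - w n) * exp (w n) else 1)
      = (\<Prod>p\<in>{p. prime p \<and> p < N}. 1 - w p) * exp (\<Sum>n<N. b n / of_nat n powr s)" for N
  proof -
    have "(\<Prod>n<N. if prime n then (1 - w n) * exp (w n) else 1)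
        = (\<Prod>n<N. (if prime n then 1 - w n else 1) * exp (b n / of_nat n powr s))"
      by (intro prod.cong) (auto simp: b_def w_def)
    also have "\<dots> = (\<Prod>n<N. if prime n then 1 - w n else 1) * exp (\<Sum>n<N. b n / of_nat n powr s)"
      by (simp add: prod.distrib exp_sum)
    also have "(\<Prod>n<N. if prime n then 1 - w n else 1) = (\<Prod>p\<in>{p. prime p \<and> p < N}. 1 - w p)"
      by (rule prod.mono_neutral_cong_right) auto
    finally show ?thesis .
  qed
  have b: "norm (b n) \<le> 1" for n using a by (auto simp: b_def)
  have "(\<lambda>n. b (Suc n) / of_nat (Suc n) powr s) sums dirichlet_series b s"
    by (rule dirichlet_series_sums_gt_1[OF b s])
  \<comment> \<open>The extra term at index 0 vanishes, since 0 is not prime.\<close>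
  then have "(\<lambda>n. b n / of_nat n powr s) sums (dirichlet_series b s + b 0 / of_nat 0 powr s)"
    by (rule sums_Suc)
  then have lim1: "(\<lambda>N. exp (\<Sum>n<N. b n / of_nat n powr s)) \<longlonglongrightarrow> exp (dirichlet_series b s)"
    by (intro tendsto_intros) (simp add: sums_def)
  have "(\<lambda>N. (\<Prod>p\<in>{p. prime p \<and> p < N}. 1 - w p) * dirichlet_series a s) \<longlonglongrightarrow> 1"
    using dirichlet_series_sieve_tendsto[of a s, OF a s]
    by (subst (asm) dirichlet_series_sieve[of a s, OF mult a(1) s]) (auto simp: w_def)
  from tendsto_mult[OF this lim1]
  have "(\<lambda>N. dirichlet_series a s * (\<Prod>n<N. if prime n then (1 - w n) * exp (w n) else 1)) \<longlonglongrightarrow> exp (dirichlet_series b s)"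
    by (simp add: prod_eq mult_ac)
  moreover have "(\<lambda>N. dirichlet_series a s * (\<Prod>n<N. if prime n then (1 - w n) * exp (w n) else 1)) \<longlonglongrightarrow> dirichlet_series a s * R"
    unfolding w_def using R by (intro tendsto_mult tendsto_const)
  ultimately show ?thesis
    unfolding b_def by (intro LIMSEQ_unique)
qed

text \<open>Only the real parts of \<open>chi p\<close> are controlled, hence the product with the conjugate character.\<close>
lemma dirichlet_L_nonzero:
  assumes chi: "dirichlet_character q chi" and q: "q > 0" and c: "coprime c q" "chi c \<noteq> 1"
    and bound: "\<And>n. \<bar>\<Sum>k<n. if prime (Suc k) then Re (chi (Suc k)) else 0\<bar> \<le> C * real n powr \<theta>"
    and \<theta>: "\<theta> \<ge> 1/2" and s: "Re s > \<theta>"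
  shows "dirichlet_series chi s * dirichlet_series (\<lambda>n. cnj (chi n)) s \<noteq> 0"
proof -
  define psi where "psi = (\<lambda>n. cnj (chi n))"
  have psi: "dirichlet_character q psi" unfolding psi_def by (rule dirichlet_character_cnj[OF chi])
  have c': "psi c \<noteq> 1" using c by (simp add: psi_def)
  \<comment> \<open>\<open>2 * Re (chi p)\<close> is \<open>chi p + cnj (chi p)\<close>: the
    combined prime coefficient of the two L-functions.\<close>
  define h where "h = (\<lambda>n. complex_of_real (if prime n then 2 * Re (chi n) else 0))"
  define U where "U = {s::complex. Re s > \<theta>}"
  have le: "norm (chi n) \<le> 1" "norm (psi n) \<le> 1" for n
    using dirichlet_character_norm_le[OF chi q] dirichlet_character_norm_le[OF psi q] by auto
  have h: "norm (\<Sum>k<n. h (Suc k)) \<le> 2 * C * real n powr \<theta>" for n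
  proof -
    have "(\<Sum>k<n. h (Suc k)) = of_real (2 * (\<Sum>k<n. if prime (Suc k) then Re (chi (Suc k)) else 0))"
      unfolding sum_distrib_left of_real_sum by (intro sum.cong) (auto simp: h_def)
    then have "norm (\<Sum>k<n. h (Suc k)) = 2 * \<bar>\<Sum>k<n. if prime (Suc k) then Re (chi (Suc k)) else 0\<bar>"
      by (simp only: norm_of_real abs_mult abs_numeral)
    with bound[of n] show ?thesis by simp
  qed
  obtain R where R: "R holomorphic_on {s. Re s > 1/2}"
    "\<And>s. Re s > 1/2 \<Longrightarrow> (\<lambda>N. \<Prod>n<N. if prime n then (1 - chi n / of_nat n powr s) * exp (chi n / of_nat n powr s) else 1) \<longlonglongrightarrow> R s"
    using regularized_euler_product[of chi, OF le(1)] by blast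
  obtain R' where R': "R' holomorphic_on {s. Re s > 1/2}"
    "\<And>s. Re s > 1/2 \<Longrightarrow> (\<lambda>N. \<Prod>n<N. if prime n then (1 - psi n / of_nat n powr s) * exp (psi n / of_nat n powr s) else 1) \<longlonglongrightarrow> R' s"
    using regularized_euler_product[of psi, OF le(2)] by blast
  define F where "F = (\<lambda>s. dirichlet_series chi s * R s * (dirichlet_series psi s * R' s))"
  have "F s = exp (dirichlet_series h s)"
  \<comment> \<open>The identity is known where the Euler products converge absolutely and spreads
    to \<open>U\<close>. Since \<theta> is only bounded from below, the maximum keeps the smaller
    half-plane inside \<open>U\<close>.\<close>
  proof (rule analytic_continuation_open[of "{s. Re s > max 1 \<theta>}" U F "\<lambda>s. exp (dirichlet_series h s)"])
    show "open {s. Re s > max 1 \<theta>}" by (rule open_halfspace_Re_gt)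
    show "open U" "{s. Re s > max 1 \<theta>} \<subseteq> U"
      by (auto simp: U_def open_halfspace_Re_gt)
    have "of_real (max 1 \<theta> + 1) \<in> {s. Re s > max 1 \<theta>}" by (auto simp: max_def)
    then show "{s. Re s > max 1 \<theta>} \<noteq> {}" by blast
    show "connected U" unfolding U_def by (intro convex_connected convex_halfspace_Re_gt)
    have U: "U \<subseteq> {s. Re s > 0}" "U \<subseteq> {s. Re s > 1/2}" using \<theta> by (auto simp: U_def)
    show "F holomorphic_on U"
      unfolding F_def
      by (intro holomorphic_on_mult
          holomorphic_on_subset[OF dirichlet_L_holomorphic[OF chi q c] U(1)]
          holomorphic_on_subset[OF dirichlet_L_holomorphic[OF psi q c(1) c'] U(1)]
          holomorphic_on_subset[OF R(1) U(2)] holomorphic_on_subset[OF R'(1) U(2)])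
    show "(\<lambda>s. exp (dirichlet_series h s)) holomorphic_on U"
      unfolding U_def using \<theta> by (intro holomorphic_intros dirichlet_series_holomorphic[OF h]) auto
    show "s \<in> U" using s by (simp add: U_def)
  next
    fix z assume "z \<in> {s. Re s > max 1 \<theta>}"
    then have z: "Re z > 1" "Re z > 1/2" by auto
    define b :: "(nat \<Rightarrow> complex) \<Rightarrow> nat \<Rightarrow> complex" where "b = (\<lambda>f n. if prime n then f n else 0)"
    have "dirichlet_series chi z * R z = exp (dirichlet_series (b chi) z)"
      unfolding b_def using dirichlet_character_mult[OF chi] dirichlet_character_1[OF chi] le R(2) z
      by (intro dirichlet_series_times_euler_product) auto
    moreover have "dirichlet_series psi z * R' z = exp (dirichlet_series (b psi) z)"
      unfolding b_def using dirichlet_character_mult[OF psi] dirichlet_character_1[OF psi] le R'(2) z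
      by (intro dirichlet_series_times_euler_product) auto
    moreover have "dirichlet_series h z = dirichlet_series (b chi) z + dirichlet_series (b psi) z"
    proof -
      have "h n = b chi n + b psi n" for n
        by (simp add: h_def b_def psi_def complex_add_cnj)
      moreover have "(\<lambda>n. b chi (Suc n) / of_nat (Suc n) powr z + b psi (Suc n) / of_nat (Suc n) powr z)
          sums (dirichlet_series (b chi) z + dirichlet_series (b psi) z)"
        by (intro sums_add dirichlet_series_sums_gt_1 z) (auto simp: b_def le)
      ultimately show ?thesis
        unfolding dirichlet_series_def[of h] by (simp add: add_divide_distrib sums_iff)
    qed
    ultimately show "F z = exp (dirichlet_series h z)"
      by (simp add: F_def exp_add)
  qed
  then have "F s \<noteq> 0" by simp
  then show ?thesis by (auto simp: F_def psi_def)
qed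

section \<open>Mellin transforms\<close>

lemma mellin_scale:
  fixes f :: "real \<Rightarrow> complex"
  assumes f: "(\<lambda>t. of_real t powr (z - 1) * f t) absolutely_integrable_on {0<..}" and a: "a > 0"
  shows "(\<lambda>t. of_real t powr (z - 1) * f (a * t)) absolutely_integrable_on {0<..}"
    and "integral {0<..} (\<lambda>t. of_real t powr (z - 1) * f (a * t))
           = integral {0<..} (\<lambda>t. of_real t powr (z - 1) * f t) / of_real a powr z"
proof -
  let ?F = "\<lambda>t. of_real t powr (z - 1) * f t"
  have img: "(*) a ` {0<..} = {0::real<..}"
    using a by (auto simp: image_iff intro!: bexI[of _ "x / a" for x])
  let ?G = "\<lambda>x. \<bar>a\<bar> *\<^sub>R ?F (a * x)"
  let ?H = "\<lambda>x. of_real a powr z * (of_real x powr (z - 1) * f (a * x))"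
  have G: "?G absolutely_integrable_on {0<..} \<and> integral {0<..} ?G = integral {0<..} ?F"
    using has_absolute_integral_change_of_variables_real
            [of "{0<..}" "(*) a" "\<lambda>_. a" ?F "integral {0<..} ?F"] f a
    by (auto simp: img inj_on_def intro!: derivative_eq_intros)
  have eq: "?G x = ?H x" if "x \<in> {0<..}" for x
  proof -
    have "of_real (a * x) powr (z - 1) = of_real a powr (z - 1) * of_real x powr (z - 1)"
      using a that by (simp add: powr_times_real)
    moreover have "of_real a * of_real a powr (z - 1) = of_real a powr z"
      using a by (simp add: powr_diff)
    ultimately show ?thesis
      using a by (simp add: scaleR_conv_of_real mult.assoc[symmetric])
  qed
  have "?H absolutely_integrable_on {0<..} \<longleftrightarrow> ?G absolutely_integrable_on {0<..}"
    by (rule set_integrable_cong) (simp_all only: eq)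
  moreover have "integral {0<..} ?G = integral {0<..} ?H"
    by (rule Henstock_Kurzweil_Integration.integral_cong) (rule eq)
  ultimately have *: "?H absolutely_integrable_on {0<..}" "integral {0<..} ?H = integral {0<..} ?F"
    using G by auto
  have nz: "of_real a powr z \<noteq> 0" using a by simp
  show 1: "(\<lambda>t. of_real t powr (z - 1) * f (a * t)) absolutely_integrable_on {0<..}"
    using set_integrable_mult_right[of "1 / of_real a powr z" lebesgue "{0<..}", OF *(1)] nz by simp
  have "integral {0<..} (\<lambda>x. of_real a powr z * (of_real x powr (z - 1) * f (a * x)))
     = of_real a powr z * integral {0<..} (\<lambda>t. of_real t powr (z - 1) * f (a * t))"
    by (rule integral_mult_right)
  then show "integral {0<..} (\<lambda>t. of_real t powr (z - 1) * f (a * t))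
           = integral {0<..} ?F / of_real a powr z"
    using *(2) nz by (simp add: field_simps)
qed

lemma mellin_exp:
  assumes z: "Re z > 0" and a: "a > 0"
  shows "(\<lambda>t. of_real t powr (z - 1) * of_real (exp (- (a * t)))) absolutely_integrable_on {0<..}" (is ?A)
    and "((\<lambda>t. of_real t powr (z - 1) * of_real (exp (- (a * t)))) has_integral Gamma z / of_real a powr z) {0<..}" (is ?B)
proof -
  have "(\<lambda>t. of_real t powr (z - 1) * of_real (exp (- t))) absolutely_integrable_on {0<..}"
    using absolutely_integrable_Gamma_integral'[OF z] by (simp add: exp_minus field_simps)
  note * = mellin_scale[OF this a]
  show ?A using *(1) .
  then have "(\<lambda>t. of_real t powr (z - 1) * of_real (exp (- (a * t)))) integrable_on {0<..}"
    using set_lebesgue_integral_eq_integral(1) by blast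
  moreover have "((\<lambda>t. of_real t powr (z - 1) * of_real (exp (- t))) has_integral Gamma z) {0<..}"
    using Gamma_integral_complex'[OF z] by (simp add: exp_minus field_simps)
  ultimately show ?B
    using *(2) by (simp add: has_integral_iff)
qed


text \<open>Because \<open>r < p\<close>, the minimum is \<open>x powr p\<close> up to 1 and
  \<open>x powr r\<close> from 1 on, each integrable there. It supplies majorants for integrands
  governed by different powers at 0 and at infinity.\<close>

lemma integrable_min_powr:
  fixes p r :: real
  assumes "p > -1" "r < -1"
  shows "(\<lambda>x. min (x powr p) (x powr r)) integrable_on {0<..}"
proof -
  let ?f = "\<lambda>x::real. min (x powr p) (x powr r)"
  have "(\<lambda>x. x powr p) integrable_on {0<..1}"
    by (rule integrable_on_powr_from_0') (use assms in auto)
  then have "?f integrable_on {0<..1}"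
    by (rule integrable_eq) (use assms in \<open>auto simp: min_def intro: powr_mono'\<close>)
  moreover have "(\<lambda>x. x powr r) integrable_on {1..}"
    using has_integral_powr_to_inf[of r 1] assms by (auto simp: integrable_on_def)
  then have "?f integrable_on {1..}"
    by (rule integrable_eq) (use assms in \<open>auto simp: min_def powr_mono intro: order_antisym powr_mono\<close>)
  ultimately have "?f integrable_on ({0<..1} \<union> {1..})"
    by (rule integrable_Un') (auto simp: Int_def negligible_sing intro: negligible_subset[of "{1}"])
  also have "{0<..1} \<union> {1..} = {0::real<..}" by auto
  finally show ?thesis .
qed

lemma absolutely_integrable_continuous_bound:
  fixes f :: "real \<Rightarrow> complex"
  assumes "continuous_on {0<..} f" "h integrable_on {0<..}" "\<And>x. x > 0 \<Longrightarrow> norm (f x) \<le> h x"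
  shows "f absolutely_integrable_on {0<..}"
  by (rule measurable_bounded_by_integrable_imp_absolutely_integrable[where g = h])
     (use assms in \<open>auto intro!: continuous_imp_measurable_on_sets_lebesgue\<close>)

text \<open>A bridge from gauge integrals and the completed measure \<open>lebesgue\<close> to
  \<open>lborel\<close>, the measure for which Fubini's theorem is applied below.\<close>

lemma absolutely_integrable_lborel:
  fixes f :: "real \<Rightarrow> complex"
  assumes "f absolutely_integrable_on S" "(f has_integral b) S"
    and meas: "(\<lambda>x. indicator S x *\<^sub>R f x) \<in> borel_measurable borel"
  shows "integrable lborel (\<lambda>x. indicator S x *\<^sub>R f x)"
    and "integral\<^sup>L lborel (\<lambda>x. indicator S x *\<^sub>R f x) = b"
proof -
  show 1: "integrable lborel (\<lambda>x. indicator S x *\<^sub>R f x)"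
    using assms(1) meas unfolding set_integrable_def by (simp add: integrable_completion)
  have "b = set_lebesgue_integral lebesgue S f"
    using set_lebesgue_integral_eq_integral(2)[OF assms(1)] assms(2) by (simp add: integral_unique)
  also have "\<dots> = integral\<^sup>L lborel (\<lambda>x. indicator S x *\<^sub>R f x)"
    unfolding set_lebesgue_integral_def using meas by (simp add: integral_completion)
  finally show "integral\<^sup>L lborel (\<lambda>x. indicator S x *\<^sub>R f x) = b" ..
qed

section \<open>Mellin transforms of rational functions\<close>

lemma mellin_inverse_1_plus_absolutely_integrable:
  assumes z: "0 < Re z" "Re z < 1"
  shows "(\<lambda>v. of_real v powr (z - 1) * of_real (1 / (1 + v))) absolutely_integrable_on {0<..}"
proof (rule absolutely_integrable_continuous_bound)
  show "continuous_on {0<..} (\<lambda>v. complex_of_real v powr (z - 1) * of_real (1 / (1 + v)))"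
    by (intro continuous_intros) (auto simp: complex_nonpos_Reals_iff)
  show "(\<lambda>x. min (x powr (Re z - 1)) (x powr (Re z - 2))) integrable_on {0<..}"
    by (rule integrable_min_powr) (use z in auto)
  fix x :: real assume x: "x > 0"
  have "norm (of_real x powr (z - 1) * of_real (1 / (1 + x))) = x powr (Re z - 1) * (1 / (1 + x))"
    using x by (simp add: norm_mult norm_divide norm_powr_real_powr flip: of_real_add) 
  moreover have "x powr (Re z - 1) * (1 / (1 + x)) \<le> x powr (Re z - 1) * 1"
    using x by (intro mult_left_mono) auto
  moreover have "x powr (Re z - 1) * (1 / (1 + x)) \<le> x powr (Re z - 1) * (1 / x)"
    using x by (intro mult_left_mono) (auto simp: field_simps)
  moreover have "x powr (Re z - 1) * (1 / x) = x powr (Re z - 2)"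
    using x by (simp add: powr_diff powr_numeral power2_eq_square)
  ultimately show "norm (of_real x powr (z - 1) * of_real (1 / (1 + x))) \<le> min (x powr (Re z - 1)) (x powr (Re z - 2))"
    by simp
qed


text \<open>Fubini applied to \<open>v powr (z - 1) * exp (- (1 + v) y)\<close>.\<close>
lemma mellin_inverse_1_plus:
  assumes z: "0 < Re z" "Re z < 1"
  shows "((\<lambda>v. of_real v powr (z - 1) * of_real (1 / (1 + v))) has_integral Gamma z * Gamma (1 - z)) {0<..}"
proof -
  define I :: "real \<Rightarrow> real" where "I = indicator {0<..}"
  \<comment> \<open>This is \<open>v powr (z - 1)\<close> cut off to \<open>v > 0\<close>; with
    \<open>exp\<close> and \<open>ln\<close> in place of the complex power, Borel measurability is
    automatic.\<close>
  define f :: "real \<Rightarrow> complex" where "f = (\<lambda>v. I v *\<^sub>R exp ((z - 1) * of_real (ln v)))"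
  define F where "F = (\<lambda>v y. f v * (I y *\<^sub>R of_real (exp (- ((1 + v) * y)))))"
  have powr_eq: "of_real v powr w = exp (w * of_real (ln v))" if "v > 0" for v :: real and w :: complex
    using that by (simp add: powr_def Ln_of_real)
  have [measurable]: "I \<in> borel_measurable borel" "f \<in> borel_measurable borel"
    unfolding f_def I_def by measurable
  have I1: "integrable lborel (\<lambda>y. I y *\<^sub>R complex_of_real (exp (- ((1 + v) * y))))"
           "integral\<^sup>L lborel (\<lambda>y. I y *\<^sub>R complex_of_real (exp (- ((1 + v) * y)))) = of_real (1 / (1 + v))"
    if v: "v > 0" for v
  proof -
    have "(\<lambda>y. of_real y powr (1 - 1) * of_real (exp (- ((1 + v) * y))) :: complex) absolutely_integrable_on {0<..}"
         "((\<lambda>y. of_real y powr (1 - 1) * of_real (exp (- ((1 + v) * y)))) has_integral Gamma 1 / of_real (1 + v) powr (1 :: complex)) {0<..}"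
      by (rule mellin_exp; use v in simp)+
    moreover have "of_real (1 + v) powr (1 :: complex) = of_real (1 + v)"
      using v by (subst powr_to_1) (auto simp flip: of_real_add)
    moreover have "(of_real y powr (1 - 1) * of_real (exp (- ((1 + v) * y))) :: complex) = of_real (exp (- ((1 + v) * y)))"
      if "y \<in> {0<..}" for y using that by simp
    ultimately have "(\<lambda>y. complex_of_real (exp (- ((1 + v) * y)))) absolutely_integrable_on {0<..}"
         "((\<lambda>y. complex_of_real (exp (- ((1 + v) * y)))) has_integral of_real (1 / (1 + v))) {0<..}"
      using set_integrable_cong[OF refl refl, of "{0<..}" "\<lambda>y. of_real y powr (1 - 1) * of_real (exp (- ((1 + v) * y))) :: complex"
           "\<lambda>y. complex_of_real (exp (- ((1 + v) * y)))" lebesgue]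
        has_integral_cong[of "{0<..}" "\<lambda>y. of_real y powr (1 - 1) * of_real (exp (- ((1 + v) * y))) :: complex"
           "\<lambda>y. complex_of_real (exp (- ((1 + v) * y)))"]
      by (simp_all only: Gamma_1 of_real_divide of_real_1)
    note * = absolutely_integrable_lborel[OF this]
    show "integrable lborel (\<lambda>y. I y *\<^sub>R complex_of_real (exp (- ((1 + v) * y))))"
           "integral\<^sup>L lborel (\<lambda>y. I y *\<^sub>R complex_of_real (exp (- ((1 + v) * y)))) = of_real (1 / (1 + v))"
      unfolding I_def by (rule *; measurable)+
  qed
  \<comment> \<open>Integrating over \<open>v\<close> first leaves
    \<open>Gamma z * y powr (-z) * exp (-y)\<close>. The exponent is written
    \<open>(1 - z) - 1\<close> so that the outer integral is again a Gamma integral, now at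
    \<open>1 - z\<close>.\<close>
  have I2: "integral\<^sup>L lborel (\<lambda>v. F v y) = I y *\<^sub>R (Gamma z * (of_real y powr ((1 - z) - 1) * of_real (exp (- (1 * y)))))" for y
  proof (cases "y > 0")
    case True
    have "integral\<^sup>L lborel (\<lambda>v. indicator {0<..} v *\<^sub>R (complex_of_real v powr (z - 1) * of_real (exp (- (y * v)))))
        = Gamma z / of_real y powr z"
    proof (rule absolutely_integrable_lborel(2)[OF mellin_exp[OF z(1) True]])
      have "(\<lambda>v. indicator {0<..} v *\<^sub>R (complex_of_real v powr (z - 1) * of_real (exp (- (y * v)))))
          = (\<lambda>v. f v * of_real (exp (- (y * v))))"
        by (auto simp: fun_eq_iff f_def I_def indicator_def powr_eq)
      then show "(\<lambda>v. indicator {0<..} v *\<^sub>R (complex_of_real v powr (z - 1) * of_real (exp (- (y * v))))) \<in> borel_measurable borel"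
        by simp
    qed
    also have "(\<lambda>v. indicator {0<..} v *\<^sub>R (complex_of_real v powr (z - 1) * of_real (exp (- (y * v)))))
          = (\<lambda>v. f v * of_real (exp (- (y * v))))"
      by (auto simp: fun_eq_iff f_def I_def indicator_def powr_eq)
    finally have *: "integral\<^sup>L lborel (\<lambda>v. f v * of_real (exp (- (y * v)))) = Gamma z / of_real y powr z" .
    have split: "exp (- ((1 + v) * y)) = exp (- y) * exp (- (y * v))" for v
      unfolding exp_add[symmetric] by (simp add: algebra_simps)
    have "(\<lambda>v. F v y) = (\<lambda>v. of_real (exp (- y)) * (f v * of_real (exp (- (y * v)))))"
      unfolding F_def split using True by (intro ext) (simp add: I_def)
    then have "integral\<^sup>L lborel (\<lambda>v. F v y) = of_real (exp (- y)) * (Gamma z / of_real y powr z)"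
      using * by simp
    then show ?thesis
      using True by (simp add: I_def powr_minus_divide)
  qed (auto simp: F_def I_def)
  have int: "integrable (lborel \<Otimes>\<^sub>M lborel) (case_prod F)"
  proof (rule lborel_pair.Fubini_integrable)
    show "case_prod F \<in> borel_measurable (lborel \<Otimes>\<^sub>M lborel)"
      unfolding F_def by measurable
    have "integrable lborel (\<lambda>y. F v y)" for v
    proof (cases "v > 0")
      case True
      show ?thesis unfolding F_def by (intro integrable_mult_right I1(1) True)
    qed (simp add: F_def f_def I_def)
    then show "AE x in lborel. integrable lborel (\<lambda>y. case_prod F (x, y))" by simp
    \<comment> \<open>The \<open>y\<close>-dependent factor is nonnegative, so taking norms changes
      only \<open>f v\<close>, and absolute integrability of the one-variable Mellin integrand is
      enough for Fubini.\<close>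
    have "(\<lambda>v. \<integral>y. norm (case_prod F (v, y)) \<partial>lborel) = (\<lambda>v. norm (f v * of_real (1 / (1 + v))))"
    proof
      fix v
      show "(\<integral>y. norm (case_prod F (v, y)) \<partial>lborel) = norm (f v * of_real (1 / (1 + v)))"
      proof (cases "v > 0")
        case True
        have "complex_of_real (\<integral>y. I y * exp (- ((1 + v) * y)) \<partial>lborel) = of_real (1 / (1 + v))"
          using I1(2)[OF True] by (simp add: scaleR_conv_of_real flip: of_real_mult)
        then have "(\<integral>y. I y * exp (- ((1 + v) * y)) \<partial>lborel) = 1 / (1 + v)"
          by (simp only: of_real_eq_iff)
        moreover have "norm (case_prod F (v, y)) = norm (f v) * (I y * exp (- ((1 + v) * y)))" for y
          by (simp add: F_def norm_mult I_def)
        ultimately show ?thesis using True by (simp add: norm_mult norm_divide flip: of_real_add)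
      qed (simp add: F_def f_def I_def)
    qed
    moreover have "integrable lborel (\<lambda>v. f v * of_real (1 / (1 + v)))"
    proof -
      have "(\<lambda>v. indicator {0<..} v *\<^sub>R (complex_of_real v powr (z - 1) * of_real (1 / (1 + v))))
          = (\<lambda>v. f v * of_real (1 / (1 + v)))"
        by (auto simp: fun_eq_iff f_def I_def indicator_def powr_eq)
      moreover have "(\<lambda>v. f v * of_real (1 / (1 + v))) \<in> borel_measurable borel" by measurable
      ultimately show ?thesis
        using mellin_inverse_1_plus_absolutely_integrable[OF z] unfolding set_integrable_def
        by (simp add: integrable_completion)
    qed
    ultimately show "integrable lborel (\<lambda>v. \<integral>y. norm (case_prod F (v, y)) \<partial>lborel)"
      by (simp only: integrable_norm)
  qed
  have "Gamma z * Gamma (1 - z) = (\<integral>y. (\<integral>v. F v y \<partial>lborel) \<partial>lborel)"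
  proof -
    have "integral\<^sup>L lborel (\<lambda>y. indicator {0<..} y *\<^sub>R (complex_of_real y powr ((1 - z) - 1) * of_real (exp (- (1 * y)))))
        = Gamma (1 - z) / of_real 1 powr (1 - z)"
    proof (rule absolutely_integrable_lborel(2)[OF mellin_exp])
      have "(\<lambda>y. indicator {0<..} y *\<^sub>R (complex_of_real y powr ((1 - z) - 1) * of_real (exp (- (1 * y)))))
        = (\<lambda>y. I y *\<^sub>R (exp (((1 - z) - 1) * of_real (ln y)) * of_real (exp (- (1 * y)))))"
        by (auto simp: fun_eq_iff I_def indicator_def powr_eq)
      then show "(\<lambda>y. indicator {0<..} y *\<^sub>R (complex_of_real y powr ((1 - z) - 1) * of_real (exp (- (1 * y))))) \<in> borel_measurable borel"
        by simp
    qed (use z in auto)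
    then have "integral\<^sup>L lborel (\<lambda>y. Gamma z * (I y *\<^sub>R (complex_of_real y powr ((1 - z) - 1) * of_real (exp (- (1 * y))))))
        = Gamma z * Gamma (1 - z)"
      unfolding integral_mult_right_zero I_def by simp
    then show ?thesis unfolding I2 by (simp only: mult_scaleR_right)
  qed
  also have "\<dots> = (\<integral>v. (\<integral>y. F v y \<partial>lborel) \<partial>lborel)"
    by (rule lborel_pair.Fubini_integral) (rule int)
  also have "\<dots> = (\<integral>v. indicator {0<..} v *\<^sub>R (complex_of_real v powr (z - 1) * of_real (1 / (1 + v))) \<partial>lborel)"
  proof (rule Bochner_Integration.integral_cong[OF refl])
    fix v
    show "(\<integral>y. F v y \<partial>lborel) = indicator {0<..} v *\<^sub>R (complex_of_real v powr (z - 1) * of_real (1 / (1 + v)))"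
    proof (cases "v > 0")
      case True
      have "(\<integral>y. F v y \<partial>lborel) = f v * of_real (1 / (1 + v))"
        unfolding F_def by (simp only: integral_mult_right_zero I1(2)[OF True])
      then show ?thesis using True by (simp add: f_def I_def powr_eq)
    qed (simp add: F_def f_def I_def)
  qed
  also have "\<dots> = integral {0<..} (\<lambda>v. complex_of_real v powr (z - 1) * of_real (1 / (1 + v)))"
  proof (rule absolutely_integrable_lborel(2)[OF mellin_inverse_1_plus_absolutely_integrable[OF z]])
    show "((\<lambda>v. complex_of_real v powr (z - 1) * of_real (1 / (1 + v))) has_integral
            integral {0<..} (\<lambda>v. complex_of_real v powr (z - 1) * of_real (1 / (1 + v)))) {0<..}"
      using mellin_inverse_1_plus_absolutely_integrable[OF z] set_lebesgue_integral_eq_integral(1) by blast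
    have "(\<lambda>v. indicator {0<..} v *\<^sub>R (complex_of_real v powr (z - 1) * of_real (1 / (1 + v))))
          = (\<lambda>v. f v * of_real (1 / (1 + v)))"
      by (auto simp: fun_eq_iff f_def I_def indicator_def powr_eq)
    then show "(\<lambda>v. indicator {0<..} v *\<^sub>R (complex_of_real v powr (z - 1) * of_real (1 / (1 + v)))) \<in> borel_measurable borel"
      by simp
  qed
  finally show ?thesis
    using mellin_inverse_1_plus_absolutely_integrable[OF z] set_lebesgue_integral_eq_integral(1)
    by (metis has_integral_iff)
qed


text \<open>Substitution \<open>v = u\<^sup>2\<close> with \<open>z = s / 2\<close>: the Jacobian
  \<open>2 * u\<close> produces the final factor 1/2, and the strip of width 1 becomes one of width
  2.\<close>

lemma mellin_inverse_1_plus_square: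
  assumes s: "0 < Re s" "Re s < 2"
  shows "(\<lambda>u. of_real u powr (s - 1) * of_real (1 / (1 + u\<^sup>2))) absolutely_integrable_on {0<..}" (is ?A)
    and "integral {0<..} (\<lambda>u. of_real u powr (s - 1) * of_real (1 / (1 + u\<^sup>2)))
           = Gamma (s / 2) * Gamma (1 - s / 2) / 2" (is ?B)
proof -
  let ?F = "\<lambda>v. of_real v powr (s / 2 - 1) * complex_of_real (1 / (1 + v))"
  let ?G = "\<lambda>u. of_real u powr (s - 1) * complex_of_real (1 / (1 + u\<^sup>2))"
  have z: "0 < Re (s / 2)" "Re (s / 2) < 1" using s by auto
  have img: "(\<lambda>u::real. u\<^sup>2) ` {0<..} = {0<..}"
  proof (intro equalityI subsetI)
    fix x :: real assume "x \<in> {0<..}"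
    then show "x \<in> (\<lambda>u::real. u\<^sup>2) ` {0<..}"
      by (intro image_eqI[of _ _ "sqrt x"]) auto
  qed auto
  have inj: "inj_on (\<lambda>u::real. u\<^sup>2) {0<..}"
    by (auto simp: inj_on_def)
  have FG: "(\<lambda>u. \<bar>2 * u\<bar> *\<^sub>R ?F (u\<^sup>2)) absolutely_integrable_on {0<..} \<and>
        integral {0<..} (\<lambda>u. \<bar>2 * u\<bar> *\<^sub>R ?F (u\<^sup>2)) = Gamma (s / 2) * Gamma (1 - s / 2)"
  proof (subst has_absolute_integral_change_of_variables_real)
    show "((\<lambda>u. u\<^sup>2) has_field_derivative 2 * x) (at x within {0<..})" for x :: real
      by (auto intro!: derivative_eq_intros)
    show "?F absolutely_integrable_on (\<lambda>u. u\<^sup>2) ` {0<..} \<and>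
          integral ((\<lambda>u. u\<^sup>2) ` {0<..}) ?F = Gamma (s / 2) * Gamma (1 - s / 2)"
      unfolding img using mellin_inverse_1_plus_absolutely_integrable[OF z] mellin_inverse_1_plus[OF z]
      by (auto simp: integral_unique)
  qed (use inj in auto)
  have "\<bar>2 * u\<bar> *\<^sub>R ?F (u\<^sup>2) = 2 * ?G u" if "u \<in> {0<..}" for u
  proof -
    have u: "u > 0" using that by simp
    have "of_real (u\<^sup>2) powr (s / 2 - 1) = exp ((s / 2 - 1) * of_real (2 * ln u))"
      using u by (simp add: powr_def Ln_of_real ln_realpow flip: of_real_power)
    also have "\<dots> = exp ((s - 1) * of_real (ln u) - of_real (ln u))"
      by (simp add: algebra_simps)
    also have "\<dots> = of_real u powr (s - 1) / of_real u"
      using u by (simp add: exp_diff exp_of_real powr_def Ln_of_real)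
    finally show ?thesis using u
      by (simp add: scaleR_conv_of_real)
  qed
  note eq = this
  have "(\<lambda>u. 2 * ?G u) absolutely_integrable_on {0<..} \<longleftrightarrow> (\<lambda>u. \<bar>2 * u\<bar> *\<^sub>R ?F (u\<^sup>2)) absolutely_integrable_on {0<..}"
    by (rule set_integrable_cong) (simp_all only: eq)
  moreover have "integral {0<..} (\<lambda>u. \<bar>2 * u\<bar> *\<^sub>R ?F (u\<^sup>2)) = integral {0<..} (\<lambda>u. 2 * ?G u)"
    by (rule Henstock_Kurzweil_Integration.integral_cong) (rule eq)
  ultimately have *: "(\<lambda>u. 2 * ?G u) absolutely_integrable_on {0<..}"
     "integral {0<..} (\<lambda>u. 2 * ?G u) = Gamma (s / 2) * Gamma (1 - s / 2)"
    using FG by auto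
  show ?A
    using set_integrable_mult_right[of "1/2" lebesgue "{0<..}" "\<lambda>u. 2 * ?G u", OF *(1)] by simp
  have "integral {0<..} (\<lambda>u. 2 * ?G u) = 2 * integral {0<..} ?G"
    by (rule integral_mult_right)
  with *(2) show ?B by simp
qed

text \<open>The kernel is \<open>2 * u / (1 + u\<^sup>2)\<close> for \<open>\<epsilon> = 1\<close>
  and \<open>2 * \<i> / (1 + u\<^sup>2)\<close> for \<open>\<epsilon> = -1\<close>. Its Mellin
  transform is therefore that of \<open>1 / (1 + u\<^sup>2)\<close> at \<open>s + 1\<close> or at
  \<open>s\<close>, up to a constant, and a product of Gamma values is never 0.\<close>

lemma mellin_kernel:
  assumes s: "0 < Re s" "Re s < 1" and \<epsilon>: "\<epsilon> = 1 \<or> \<epsilon> = -1"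
  defines "k \<equiv> \<lambda>u::real. 1 / (of_real u - \<i>) + \<epsilon> / (of_real u + \<i>)"
  shows "(\<lambda>u. of_real u powr (s - 1) * k u) absolutely_integrable_on {0<..}"
    and "integral {0<..} (\<lambda>u. of_real u powr (s - 1) * k u) \<noteq> 0"
proof -
  have nz: "of_real u - \<i> \<noteq> 0" "of_real u + \<i> \<noteq> 0" "1 + (of_real u)\<^sup>2 \<noteq> (0::complex)" for u
    by (auto simp: complex_eq_iff power2_eq_square add_nonneg_eq_0_iff)
  have prod: "(of_real u - \<i>) * (of_real u + \<i>) = 1 + (of_real u)\<^sup>2" for u
    by (simp add: algebra_simps power2_eq_square)
  have Gamma_nz: "Gamma (w / 2) * Gamma (1 - w / 2) / 2 \<noteq> 0" if "0 < Re w" "Re w < 2" for w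
  proof -
    have "Re v \<le> 0" if "v \<in> \<int>\<^sub>\<le>\<^sub>0" for v
      using that by (auto elim!: nonpos_Ints_cases)
    from this[of "w / 2"] this[of "1 - w / 2"] have "w / 2 \<notin> \<int>\<^sub>\<le>\<^sub>0" "1 - w / 2 \<notin> \<int>\<^sub>\<le>\<^sub>0"
      using that by auto
    then show ?thesis by (simp add: Gamma_eq_zero_iff)
  qed
  define c where "c = (if \<epsilon> = 1 then 2 else 2 * \<i>)"
  define w where "w = (if \<epsilon> = 1 then s + 1 else s)"
  have w: "0 < Re w" "Re w < 2" using s by (auto simp: w_def)
  have eq: "c * (of_real u powr (w - 1) * of_real (1 / (1 + u\<^sup>2))) = of_real u powr (s - 1) * k u"
    if "u \<in> {0<..}" for u
  proof (cases "\<epsilon> = 1")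
    case True
    have "k u = 2 * of_real u / (1 + (of_real u)\<^sup>2)"
      using nz by (simp add: k_def True divide_simps flip: prod)
    moreover have "of_real u powr s = of_real u powr (s - 1) * of_real u"
      using that by (simp add: powr_diff)
    ultimately show ?thesis using True by (simp add: c_def w_def)
  next
    case False
    then have "\<epsilon> = -1" using \<epsilon> by simp
    have "k u = 2 * \<i> / (1 + (of_real u)\<^sup>2)"
      unfolding k_def \<open>\<epsilon> = -1\<close> prod[symmetric] using nz by (simp add: divide_simps)
    then show ?thesis using False by (simp add: c_def w_def)
  qed
  note * = mellin_inverse_1_plus_square[OF w]
  have "(\<lambda>u. c * (of_real u powr (w - 1) * of_real (1 / (1 + u\<^sup>2)))) absolutely_integrable_on {0<..}"
    using *(1) by (intro set_integrable_mult_right)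
  also have "?this \<longleftrightarrow> (\<lambda>u. of_real u powr (s - 1) * k u) absolutely_integrable_on {0<..}"
    by (rule set_integrable_cong) (simp_all only: eq)
  finally show "(\<lambda>u. of_real u powr (s - 1) * k u) absolutely_integrable_on {0<..}" .
  have "integral {0<..} (\<lambda>u. of_real u powr (s - 1) * k u)
      = integral {0<..} (\<lambda>u. c * (of_real u powr (w - 1) * of_real (1 / (1 + u\<^sup>2))))"
    by (rule Henstock_Kurzweil_Integration.integral_cong) (simp only: eq)
  also have "\<dots> = c * integral {0<..} (\<lambda>u. of_real u powr (w - 1) * of_real (1 / (1 + u\<^sup>2)))"
    by (rule integral_mult_right)
  also have "\<dots> \<noteq> 0"
    unfolding *(2) using Gamma_nz[OF w] by (simp add: c_def)
  finally show "integral {0<..} (\<lambda>u. of_real u powr (s - 1) * k u) \<noteq> 0" .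
qed

section \<open>Partial fractions and Abel summation bounds\<close>

text \<open>Difference of the limit formulas for \<open>Digamma\<close> at \<open>1 - z\<close> and
  \<open>z\<close>, in which the logarithms cancel. The value comes from differentiating the
  reflection formula \<open>Gamma z * Gamma (1 - z) = pi / sin (pi * z)\<close> in two ways.\<close>

lemma cot_partial_fractions:
  fixes z :: complex
  assumes z: "z \<notin> \<int>"
  shows "(\<lambda>m. \<Sum>n<m. 1 / (z + of_nat n) - 1 / (1 - z + of_nat n)) \<longlonglongrightarrow> of_real pi * cot (of_real pi * z)"
proof -
  have z': "1 - z \<notin> \<int>" using z Ints_diff[OF Ints_1, of "1 - z"] by auto
  have ni: "z \<notin> \<int>\<^sub>\<le>\<^sub>0" "1 - z \<notin> \<int>\<^sub>\<le>\<^sub>0" and nz: "z \<noteq> 0" "1 - z \<noteq> 0"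
    using z z' nonpos_Ints_Int by auto
  have sin_nz: "sin (of_real pi * z) \<noteq> 0"
    using z by (auto simp: sin_eq_0 mult.commute)
  have "(\<lambda>m. (of_real (ln (real m)) - (\<Sum>n<m. inverse (1 - z + of_nat n)))
        - (of_real (ln (real m)) - (\<Sum>n<m. inverse (z + of_nat n)))) \<longlonglongrightarrow> Digamma (1 - z) - Digamma z"
    by (intro tendsto_diff Digamma_LIMSEQ nz)
  also have "(\<lambda>m. (of_real (ln (real m)) - (\<Sum>n<m. inverse (1 - z + of_nat n)))
        - (of_real (ln (real m)) - (\<Sum>n<m. inverse (z + of_nat n))))
      = (\<lambda>m. \<Sum>n<m. 1 / (z + of_nat n) - 1 / (1 - z + of_nat n))"
    by (simp add: fun_eq_iff sum_subtractf inverse_eq_divide)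
  also have "Digamma (1 - z) - Digamma z = of_real pi * cot (of_real pi * z)"
  proof -
    let ?f = "\<lambda>z::complex. Gamma z * Gamma (1 - z)"
    have "(?f has_field_derivative (?f z * (Digamma z - Digamma (1 - z)))) (at z)"
      using ni by (auto intro!: derivative_eq_intros simp: algebra_simps)
    then have "((\<lambda>z. of_real pi / sin (of_real pi * z)) has_field_derivative
        (of_real pi / sin (of_real pi * z) * (Digamma z - Digamma (1 - z)))) (at z)"
      by (simp only: Gamma_reflection_complex)
    moreover have "((\<lambda>z. of_real pi / sin (of_real pi * z)) has_field_derivative
        (- of_real pi * (cos (of_real pi * z) * of_real pi) / sin (of_real pi * z) ^ 2)) (at z)"
      using sin_nz by (auto intro!: derivative_eq_intros simp: power2_eq_square)
    ultimately have eq: "of_real pi / sin (of_real pi * z) * (Digamma z - Digamma (1 - z))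
        = - of_real pi * (cos (of_real pi * z) * of_real pi) / sin (of_real pi * z) ^ 2"
      by (rule DERIV_unique)
    have cancel: "D = - (P * C / S)" if "P \<noteq> 0" "S \<noteq> 0" "P / S * D = - P * (C * P) / S ^ 2" for P S C D :: complex
    proof -
      have "D = S / P * (P / S * D)" using that(1,2) by simp
      also have "\<dots> = - (P * C / S)" unfolding that(3) using that(1,2) by (simp add: power2_eq_square)
      finally show ?thesis .
    qed
    have "Digamma z - Digamma (1 - z) = - (of_real pi * cos (of_real pi * z) / sin (of_real pi * z))"
      by (rule cancel[OF _ sin_nz eq]) simp
    then show ?thesis by (simp add: cot_def algebra_simps)
  qed
  finally show ?thesis .
qed

text \<open>Arranged for the upper half-plane, where the last fraction is a geometric series in
  \<open>exp (2 * \<i> * z)\<close>; the constant 1/2 later disappears because the character values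
  sum to 0.\<close>

lemma cot_conv_exp:
  fixes z :: complex
  assumes "sin z \<noteq> 0"
  shows "\<i> / 2 * cot z = 1 / 2 + exp (2 * \<i> * z) / (1 - exp (2 * \<i> * z))"
proof -
  define E where "E = exp (\<i> * z)"
  have E: "E \<noteq> 0" by (simp add: E_def)
  have E2: "exp (2 * \<i> * z) = E ^ 2"
    by (simp add: E_def power2_eq_square mult.assoc flip: exp_add)
  have c: "cos z = (E + 1 / E) / 2" and s: "sin z = (E - 1 / E) / (2 * \<i>)"
    by (simp_all add: cos_exp_eq sin_exp_eq E_def exp_minus inverse_eq_divide)
  have "E - 1 / E \<noteq> 0" using assms s by auto
  then have nz: "E ^ 2 \<noteq> 1" "1 - E ^ 2 \<noteq> 0" "E * E - 1 \<noteq> 0" using E by (auto simp: field_simps power2_eq_square)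
  have "\<i> / 2 * cot z = \<i> / 2 * (((E + 1 / E) / 2) / ((E - 1 / E) / (2 * \<i>)))"
    unfolding cot_def c s ..
  also have "\<dots> = - (E ^ 2 + 1) / (2 * (E ^ 2 - 1))"
    using E nz by (simp add: divide_simps power2_eq_square)
  also have "\<dots> = 1 / 2 + E ^ 2 / (1 - E ^ 2)"
    using nz by (simp add: divide_simps) (simp add: algebra_simps)
  finally show ?thesis by (simp add: E2)
qed

text \<open>The denominator has norm at least \<open>x\<close> and at least
  \<open>\<bar>b\<bar> * k\<close>. Splitting the exponent -1 as \<open>-p + (p - 1)\<close> uses
  both bounds and gives \<open>x powr (-p)\<close> times \<open>k powr (p - 1)\<close>. Differences
  of consecutive kernels gain a further factor \<open>1 / k\<close>, so after Abel summation the
  series of \<open>k powr (p - 2)\<close> converges, and \<open>K\<close> depends on neither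
  \<open>x\<close> nor \<open>n\<close>. The free parameter \<open>p\<close> serves to adjust the
  decay in \<open>x\<close>.\<close>

lemma kernel_partial_sum_bound:
  fixes a :: "nat \<Rightarrow> complex" and b p :: real
  assumes A: "\<And>n. norm (\<Sum>k<n. a (Suc k)) \<le> A" and b: "b \<noteq> 0" and p: "0 \<le> p" "p < 1"
  obtains K where "\<And>x n. x > 0 \<Longrightarrow> norm (\<Sum>k<n. a (Suc k) / (of_real x - \<i> * of_real (b * real (Suc k)))) \<le> K * x powr (-p)"
proof -
  define c where "c = \<bar>b\<bar> powr (p - 1)"
  define S where "S = (\<Sum>k. real (Suc k) powr (p - 2))"
  have summ: "summable (\<lambda>k. real (Suc k) powr (p - 2))"
    using p by (subst summable_Suc_iff) (simp add: summable_real_powr_iff)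
  have A0: "A \<ge> 0" using order_trans[OF norm_ge_zero A] .
  show ?thesis
  proof (rule that[of "A * (c + c * S)"])
    fix x :: real and n assume x: "x > 0"
    define g where "g = (\<lambda>k. 1 / (of_real x - \<i> * of_real (b * real (Suc k))))"
    define M where "M = (\<lambda>k. norm (of_real x - \<i> * complex_of_real (b * real (Suc k))))"
    have M1: "M k \<ge> x" for k
      using abs_Re_le_cmod[of "of_real x - \<i> * complex_of_real (b * real (Suc k))"] x by (simp add: M_def)
    have M2: "M k \<ge> \<bar>b\<bar> * real (Suc k)" for k
      using abs_Im_le_cmod[of "of_real x - \<i> * complex_of_real (b * real (Suc k))"] by (simp add: M_def abs_mult)
    have Mpos: "M k > 0" for k using M1[of k] x by simp
    have M3: "1 / M k \<le> x powr (-p) * (c * real (Suc k) powr (p - 1))" for k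
    proof -
      have "1 / M k = M k powr (-p) * M k powr (p - 1)"
        unfolding powr_add[symmetric] using Mpos[of k] by (simp add: powr_minus_divide)
      also have "\<dots> \<le> x powr (-p) * (\<bar>b\<bar> * real (Suc k)) powr (p - 1)"
        using x p b M1 M2 by (intro mult_mono powr_mono2') auto
      finally show ?thesis using b by (simp add: powr_mult c_def)
    qed
    have gM: "norm (g k) = 1 / M k" for k by (simp add: g_def M_def norm_divide)
    have dg: "norm (g k - g (Suc k)) \<le> x powr (-p) * (c * real (Suc k) powr (p - 2))" for k
    proof -
      have nz: "of_real x - \<i> * complex_of_real (b * real (Suc k)) \<noteq> 0" for k
        using Mpos[of k] by (auto simp: M_def)
      have "g k - g (Suc k) = - \<i> * of_real b * g k * g (Suc k)"
      proof -
        have "1 / u - 1 / v = (v - u) * (1 / u) * (1 / v)" if "u \<noteq> 0" "v \<noteq> 0" for u v :: complex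
          using that by (simp add: field_simps)
        note inverse_diff = this[OF nz[of k] nz[of "Suc k"]]
        have "(of_real x - \<i> * of_real (b * real (Suc (Suc k)))) - (of_real x - \<i> * of_real (b * real (Suc k))) = - \<i> * of_real b"
          by (simp add: algebra_simps)
        then show ?thesis
          unfolding g_def inverse_diff by (simp only:)
      qed
      then have "norm (g k - g (Suc k)) = 1 / M k * (\<bar>b\<bar> * (1 / M (Suc k)))"
        by (simp add: norm_mult gM)
      also have "\<dots> \<le> (x powr (-p) * (c * real (Suc k) powr (p - 1))) * (1 / real (Suc k))"
      proof (intro mult_mono M3)
        have "\<bar>b\<bar> * real (Suc k) \<le> M (Suc k)"
          using M2[of "Suc k"] by (rule order_trans[rotated]) (intro mult_left_mono, auto)
        then show "\<bar>b\<bar> * (1 / M (Suc k)) \<le> 1 / real (Suc k)"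
          using Mpos[of "Suc k"] by (simp add: field_simps)
      qed (use Mpos[of "Suc k"] in \<open>auto simp: c_def\<close>)
      also have "\<dots> = x powr (-p) * (c * (real (Suc k) powr (p - 1) / real (Suc k)))" by simp
      also have "real (Suc k) powr (p - 1) / real (Suc k) = real (Suc k) powr (p - 2)"
        by (simp add: powr_diff powr_numeral power2_eq_square del: of_nat_Suc)
      finally show ?thesis .
    qed
    have "(\<Sum>k<n. a (Suc k) / (of_real x - \<i> * of_real (b * real (Suc k)))) = (\<Sum>k<n. a (Suc k) * g k)"
      by (simp add: g_def)
    also have "\<dots> = (\<Sum>k<n. a (Suc k)) * g n + (\<Sum>k<n. (\<Sum>j<Suc k. a (Suc j)) * (g k - g (Suc k)))"
      by (rule summation_by_parts)
    also have "norm \<dots> \<le> A * (x powr (-p) * c) + (\<Sum>k<n. A * (x powr (-p) * (c * real (Suc k) powr (p - 2))))"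
    proof (intro norm_triangle_mono sum_norm_le)
      have "norm (g n) \<le> x powr (-p) * (c * real (Suc n) powr (p - 1))" using M3 gM by simp
      also have "\<dots> \<le> x powr (-p) * (c * 1)"
        using p powr_mono[of "p - 1" 0 "real (Suc n)"] by (intro mult_left_mono) (auto simp: c_def)
      finally show "norm ((\<Sum>k<n. a (Suc k)) * g n) \<le> A * (x powr (-p) * c)"
        unfolding norm_mult using A A0 by (intro mult_mono) auto
      show "norm ((\<Sum>j<Suc k. a (Suc j)) * (g k - g (Suc k))) \<le> A * (x powr (-p) * (c * real (Suc k) powr (p - 2)))" for k
        unfolding norm_mult using A[of "Suc k"] A0 dg by (intro mult_mono) auto
    qed
    also have "(\<Sum>k<n. A * (x powr (-p) * (c * real (Suc k) powr (p - 2))))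
        = A * (x powr (-p) * (c * (\<Sum>k<n. real (Suc k) powr (p - 2))))"
      by (simp add: sum_distrib_left)
    also have "\<dots> \<le> A * (x powr (-p) * (c * S))"
      unfolding S_def using A0 summ by (intro mult_left_mono sum_le_suminf) (auto simp: c_def)
    finally show "norm (\<Sum>k<n. a (Suc k) / (of_real x - \<i> * of_real (b * real (Suc k)))) \<le> A * (c + c * S) * x powr (-p)"
      by (simp add: algebra_simps)
  qed
qed

text \<open>The weights decrease, so after Abel summation the bounds telescope to \<open>A\<close>
  times the first weight, uniformly in \<open>n\<close>.\<close>

lemma exp_partial_sum_bound:
  fixes a :: "nat \<Rightarrow> complex"
  assumes A: "\<And>n. norm (\<Sum>k<n. a (Suc k)) \<le> A" and x: "x > 0"
  shows "norm (\<Sum>k<n. a (Suc k) * of_real (exp (- (real (Suc k) * x)))) \<le> A * exp (- x)"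
proof -
  define g where "g = (\<lambda>k. exp (- (real (Suc k) * x)))"
  have A0: "A \<ge> 0" using order_trans[OF norm_ge_zero A] .
  have dec: "g (Suc k) \<le> g k" for k using x by (simp add: g_def algebra_simps)
  have "(\<Sum>k<n. a (Suc k) * of_real (g k))
      = (\<Sum>k<n. a (Suc k)) * of_real (g n) + (\<Sum>k<n. (\<Sum>j<Suc k. a (Suc j)) * (of_real (g k) - of_real (g (Suc k))))"
    by (rule summation_by_parts)
  also have "norm \<dots> \<le> A * g n + (\<Sum>k<n. A * (g k - g (Suc k)))"
  proof (intro norm_triangle_mono sum_norm_le)
    show "norm ((\<Sum>k<n. a (Suc k)) * of_real (g n)) \<le> A * g n"
      unfolding norm_mult using A by (intro mult_mono) (auto simp: g_def A0)
    show "norm ((\<Sum>j<Suc k. a (Suc j)) * (of_real (g k) - of_real (g (Suc k)))) \<le> A * (g k - g (Suc k))" for k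
    proof -
      have "norm (of_real (g k) - of_real (g (Suc k)) :: complex) = g k - g (Suc k)"
        using dec[of k] by (simp flip: of_real_diff)
      then show ?thesis
        unfolding norm_mult using A[of "Suc k"] dec[of k] by (intro mult_mono) (auto simp: A0)
    qed
  qed
  also have "\<dots> = A * g 0"
    unfolding sum_distrib_left[symmetric] sum_lessThan_telescope' by (simp add: algebra_simps)
  finally show ?thesis by (simp add: g_def)
qed

section \<open>Reflection of zeros for separable Gauss sums\<close>

lemma sum_lessThan_mult:
  fixes f :: "nat \<Rightarrow> 'a::comm_monoid_add"
  shows "(\<Sum>k<J * q. f k) = (\<Sum>j<J. \<Sum>r<q. f (j * q + r))"
proof (induction J)
  case (Suc J)
  have "(\<Sum>k<J * q + i. f k) = (\<Sum>k<J * q. f k) + (\<Sum>r<i. f (J * q + r))" for i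
    by (induction i) (auto simp: add.assoc)
  then show ?case using Suc by (simp add: add.commute)
qed auto

text \<open>Since \<open>x - 2 * pi * \<i> * v = - 2 * pi * \<i> * (v + \<i> * x / (2 *
  pi))\<close>, these are the cotangent partial fractions at the point \<open>z\<close> with real
  part \<open>w\<close> and imaginary part \<open>x / (2 * pi)\<close>, which is nonzero. The two
  kernels with index \<open>j\<close> belong to the shifts \<open>w + j\<close> and
  \<open>w - 1 - j\<close>, so each integer translate of \<open>w\<close> occurs once.\<close>

lemma inverse_kernel_limit:
  fixes x w :: real
  assumes x: "x > 0"
  defines "E \<equiv> of_real (exp (- x)) * cis (2 * pi * w)"
  shows "(\<lambda>J. \<Sum>j<J. 1 / (of_real x - 2 * \<i> * of_real pi * of_real (w + real j))
                   + 1 / (of_real x - 2 * \<i> * of_real pi * of_real (w - 1 - real j)))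
          \<longlonglongrightarrow> 1 / 2 + E / (1 - E)"
proof -
  define z where "z = of_real w + \<i> * of_real (x / (2 * pi))"
  have zZ: "z \<notin> \<int>"
  proof
    assume "z \<in> \<int>"
    then have "Im z = 0" by (auto elim!: Ints_cases)
    then show False using x by (simp add: z_def)
  qed
  then have sin_nz: "sin (of_real pi * z) \<noteq> 0"
    by (auto simp: sin_eq_0 mult.commute)
  have *: "1 / (of_real x - 2 * \<i> * of_real pi * v) = \<i> / (2 * of_real pi) * (1 / (v + \<i> * of_real (x / (2 * pi))))" for v :: complex
  proof -
    have "of_real x - 2 * \<i> * of_real pi * v = - (2 * \<i> * of_real pi) * (v + \<i> * of_real (x / (2 * pi)))"
      by (simp add: algebra_simps)
    moreover have "1 / (- (2 * \<i> * of_real pi) * u) = \<i> / (2 * of_real pi) * (1 / u)" for u :: complex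
      by (cases "u = 0") (simp_all add: divide_simps)
    ultimately show ?thesis by simp
  qed
  have term_eq: "1 / (of_real x - 2 * \<i> * of_real pi * of_real (w + real j))
                   + 1 / (of_real x - 2 * \<i> * of_real pi * of_real (w - 1 - real j))
     = \<i> / (2 * of_real pi) * (1 / (z + of_nat j) - 1 / (1 - z + of_nat j))" for j
  proof -
    have 1: "of_real (w + real j) + \<i> * of_real (x / (2 * pi)) = z + of_nat j" by (simp add: z_def)
    have 2: "of_real (w - 1 - real j) + \<i> * of_real (x / (2 * pi)) = - (1 - z + of_nat j)" by (simp add: z_def)
    show ?thesis
      unfolding * 1 2 minus_divide_right[symmetric] by (simp only: right_diff_distrib mult_minus_right add_uminus_conv_diff)
  qed
  have "(\<lambda>J. \<i> / (2 * of_real pi) * (\<Sum>j<J. 1 / (z + of_nat j) - 1 / (1 - z + of_nat j)))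
      \<longlonglongrightarrow> \<i> / (2 * of_real pi) * (of_real pi * cot (of_real pi * z))"
    by (intro tendsto_intros cot_partial_fractions zZ)
  also have "\<i> / (2 * of_real pi) * (of_real pi * cot (of_real pi * z)) = \<i> / 2 * cot (of_real pi * z)"
    by simp
  also have "\<dots> = 1 / 2 + exp (2 * \<i> * (of_real pi * z)) / (1 - exp (2 * \<i> * (of_real pi * z)))"
    by (rule cot_conv_exp[OF sin_nz])
  also have "exp (2 * \<i> * (of_real pi * z)) = E"
  proof -
    have "2 * \<i> * (of_real pi * z) = of_real (- x) + \<i> * of_real (2 * pi * w)"
      by (simp add: z_def algebra_simps)
    then show ?thesis
      by (simp only: exp_add exp_of_real E_def cis_conv_exp)
  qed
  finally show ?thesis by (simp only: term_eq sum_distrib_left)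
qed

text \<open>With natural numbers as arguments, \<open>q - 1\<close> plays the part of -1 modulo
  \<open>q\<close>.\<close>

lemma dirichlet_character_minus:
  assumes chi: "dirichlet_character q chi" and r: "r < q"
  shows "chi (q - r) = chi (q - 1) * chi r"
proof -
  have "(q - 1) * r + q = (q - r) + r * q"
    using r by (cases q) (auto simp: algebra_simps)
  then have "chi ((q - 1) * r) = chi (q - r)"
    using dirichlet_character_add_mult[OF chi, of "(q - 1) * r" 1] dirichlet_character_add_mult[OF chi, of "q - r" r] by simp
  then show ?thesis by (simp add: dirichlet_character_mult[OF chi])
qed

lemma dirichlet_character_minus_1:
  assumes chi: "dirichlet_character q chi" and q: "q > 1"
  shows "chi (q - 1) = 1 \<or> chi (q - 1) = -1"
proof -
  have "chi (q - 1) * chi (q - 1) = chi (Suc 0)"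
    using dirichlet_character_minus[OF chi, of "q - 1"] q by simp
  then have "(chi (q - 1))\<^sup>2 = 1" using dirichlet_character_1[OF chi] by (simp add: power2_eq_square)
  then show ?thesis by (simp add: power2_eq_1_iff)
qed

text \<open>Folding the sum over all integers onto the residues mod \<open>q\<close> turns each inner sum into
  a cotangent series.\<close>
lemma character_kernel_limit:
  assumes psi: "dirichlet_character q psi" and q: "q > 1" and c: "coprime c q" "psi c \<noteq> 1"
    and gauss: "\<And>n. (\<Sum>r<q. psi r * cis (2 * pi * (real r / real q)) ^ n) = \<tau> * chi n"
    and x: "x > 0"
  defines "b \<equiv> 2 * pi / real q"
  shows "(\<lambda>J. \<Sum>k<J * q. psi (Suc k) * (1 / (of_real x - \<i> * of_real (b * real (Suc k)))
                                + psi (q - 1) / (of_real x + \<i> * of_real (b * real (Suc k)))))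
           \<longlonglongrightarrow> \<tau> * (\<Sum>n. chi (Suc n) * of_real (exp (- (real (Suc n) * x))))"
proof -
  define g where "g = (\<lambda>v. 1 / (of_real x - 2 * \<i> * of_real pi * of_real v))"
  define E where "E = (\<lambda>r. of_real (exp (- x)) * cis (2 * pi * (real r / real q)))"
  have psi0: "psi 0 = 0" "psi q = 0"
    using dirichlet_character_eq_0_iff[OF psi, of 0] dirichlet_character_eq_0_iff[OF psi, of q] q by auto
  have g1: "1 / (of_real x - \<i> * of_real (b * real k)) = g (real k / real q)"
   and g2: "1 / (of_real x + \<i> * of_real (b * real k)) = g (- real k / real q)" for k
    unfolding g_def b_def by (simp_all add: algebra_simps)
  have per: "psi (j * q + r) = psi r" for j r
    using dirichlet_character_add_mult[OF psi, of r j] by (simp add: add.commute)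
  \<comment> \<open>Moving the range from \<open>1..J * q\<close> to \<open>0..J * q - 1\<close>
    costs nothing, because \<open>psi\<close> vanishes at multiples of \<open>q\<close>.\<close>
  have fold1: "(\<Sum>k<J * q. psi (Suc k) * g (real (Suc k) / real q)) = (\<Sum>j<J. \<Sum>r<q. psi r * g (real r / real q + real j))" for J
  proof -
    have "(\<Sum>k<J * q. psi (Suc k) * g (real (Suc k) / real q)) + psi 0 * g (real 0 / real q)
        = (\<Sum>k<Suc (J * q). psi k * g (real k / real q))"
      by (subst sum.lessThan_Suc_shift) simp
    also have "\<dots> = (\<Sum>k<J * q. psi k * g (real k / real q))"
      using per[of J 0] psi0 by simp
    also have "\<dots> = (\<Sum>j<J. \<Sum>r<q. psi (j * q + r) * g (real (j * q + r) / real q))"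
      by (rule sum_lessThan_mult)
    also have "\<dots> = (\<Sum>j<J. \<Sum>r<q. psi r * g (real r / real q + real j))"
    proof (intro sum.cong refl)
      fix j r
      have "real (j * q + r) / real q = real r / real q + real j"
        using q by (simp add: field_simps)
      then show "psi (j * q + r) * g (real (j * q + r) / real q) = psi r * g (real r / real q + real j)"
        by (simp only: per)
    qed
    finally show ?thesis using psi0 by simp
  qed
  \<comment> \<open>These are the negative integers. Each block of residues is reversed, so that the
    argument \<open>-k\<close> with \<open>k = j * q + (q - r)\<close> becomes
    \<open>r - (j + 1) * q\<close>, and \<open>psi (q - 1)\<close> turns \<open>psi k\<close> into
    \<open>psi r\<close>.\<close>
  have fold2: "(\<Sum>k<J * q. psi (Suc k) * (psi (q - 1) * g (- real (Suc k) / real q)))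
     = (\<Sum>j<J. \<Sum>r<q. psi r * g (real r / real q - 1 - real j))" for J
  proof -
    have "(\<Sum>k<J * q. psi (Suc k) * (psi (q - 1) * g (- real (Suc k) / real q)))
        = (\<Sum>j<J. \<Sum>r<q. psi (Suc (j * q + r)) * (psi (q - 1) * g (- real (Suc (j * q + r)) / real q)))"
      by (rule sum_lessThan_mult)
    also have "\<dots> = (\<Sum>j<J. \<Sum>r<q. psi (Suc (j * q + (q - Suc r))) * (psi (q - 1) * g (- real (Suc (j * q + (q - Suc r))) / real q)))"
      by (intro sum.cong refl sum.nat_diff_reindex[symmetric])
    also have "\<dots> = (\<Sum>j<J. \<Sum>r<q. psi r * g (real r / real q - 1 - real j))"
    proof (intro sum.cong refl)
      fix j r assume "r \<in> {..<q}"
      then have r: "r < q" by simp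
      have S: "Suc (j * q + (q - Suc r)) = j * q + (q - r)" using r by simp
      have "psi (Suc (j * q + (q - Suc r))) * psi (q - 1) = psi (q - 1) * psi (q - 1) * psi r"
        unfolding S per dirichlet_character_minus[OF psi r] by simp
      also have "\<dots> = psi r" using dirichlet_character_minus_1[OF psi q] by auto
      finally have "psi (Suc (j * q + (q - Suc r))) * psi (q - 1) = psi r" .
      moreover have "- real (Suc (j * q + (q - Suc r))) / real q = real r / real q - 1 - real j"
        unfolding S using r by (simp add: field_simps of_nat_diff)
      ultimately show "psi (Suc (j * q + (q - Suc r))) * (psi (q - 1) * g (- real (Suc (j * q + (q - Suc r))) / real q))
          = psi r * g (real r / real q - 1 - real j)"
        by (simp only: mult.assoc[symmetric])
    qed
    finally show ?thesis .
  qed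
  have eq: "(\<Sum>k<J * q. psi (Suc k) * (1 / (of_real x - \<i> * of_real (b * real (Suc k)))
                + psi (q - 1) / (of_real x + \<i> * of_real (b * real (Suc k)))))
      = (\<Sum>r<q. psi r * (\<Sum>j<J. g (real r / real q + real j) + g (real r / real q - 1 - real j)))" for J
  proof -
    have "psi (q - 1) / (of_real x + \<i> * of_real (b * real k)) = psi (q - 1) * g (- real k / real q)" for k
      unfolding g2[symmetric] by simp
    then have "(\<Sum>k<J * q. psi (Suc k) * (1 / (of_real x - \<i> * of_real (b * real (Suc k)))
                + psi (q - 1) / (of_real x + \<i> * of_real (b * real (Suc k)))))
        = (\<Sum>k<J * q. psi (Suc k) * g (real (Suc k) / real q)) + (\<Sum>k<J * q. psi (Suc k) * (psi (q - 1) * g (- real (Suc k) / real q)))"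
      by (simp only: g1 distrib_left sum.distrib)
    also have "\<dots> = (\<Sum>j<J. \<Sum>r<q. psi r * (g (real r / real q + real j) + g (real r / real q - 1 - real j)))"
      by (simp only: fold1 fold2 distrib_left sum.distrib)
    also have "\<dots> = (\<Sum>r<q. \<Sum>j<J. psi r * (g (real r / real q + real j) + g (real r / real q - 1 - real j)))"
      by (rule sum.swap)
    finally show ?thesis by (simp only: sum_distrib_left)
  qed
  have "(\<lambda>J. \<Sum>r<q. psi r * (\<Sum>j<J. g (real r / real q + real j) + g (real r / real q - 1 - real j)))
      \<longlonglongrightarrow> (\<Sum>r<q. psi r * (1 / 2 + E r / (1 - E r)))"
    unfolding g_def E_def by (intro tendsto_intros inverse_kernel_limit x)
  also have "(\<Sum>r<q. psi r * (1 / 2 + E r / (1 - E r))) = (\<Sum>r<q. psi r) / 2 + (\<Sum>r<q. psi r * (E r / (1 - E r)))"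
    by (simp add: distrib_left sum.distrib sum_divide_distrib)
  also have "(\<Sum>r<q. psi r) = 0"
    using dirichlet_character_sum_eq_0[OF psi _ c] q by simp
  also have "0 / 2 + (\<Sum>r<q. psi r * (E r / (1 - E r))) = \<tau> * (\<Sum>n. chi (Suc n) * of_real (exp (- (real (Suc n) * x))))"
  proof -
    have normE: "norm (E r) < 1" for r using x by (simp add: E_def norm_mult)
    \<comment> \<open>After the geometric expansion, the coefficient of
      \<open>exp (- (n + 1) * x)\<close> is a Gauss sum at \<open>n + 1\<close>, which
      \<open>gauss\<close> evaluates.\<close>
    have "(\<lambda>n. \<Sum>r<q. psi r * (E r * E r ^ n)) sums (\<Sum>r<q. psi r * (E r * (1 / (1 - E r))))"
      by (intro sums_sum sums_mult geometric_sums normE)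
    also have "(\<lambda>n. \<Sum>r<q. psi r * (E r * E r ^ n)) = (\<lambda>n. \<tau> * (chi (Suc n) * of_real (exp (- (real (Suc n) * x)))))"
    proof
      fix n
      have "E r * E r ^ n = cis (2 * pi * (real r / real q)) ^ Suc n * of_real (exp (- (real (Suc n) * x)))" for r
      proof -
        have "E r ^ Suc n = cis (2 * pi * (real r / real q)) ^ Suc n * of_real (exp (- x) ^ Suc n)"
          unfolding E_def power_mult_distrib of_real_power by (rule mult.commute)
        also have "exp (- x) ^ Suc n = exp (- (real (Suc n) * x))"
          by (simp only: exp_of_nat_mult[symmetric]) simp
        finally show ?thesis by simp
      qed
      then have "(\<Sum>r<q. psi r * (E r * E r ^ n))
          = (\<Sum>r<q. psi r * cis (2 * pi * (real r / real q)) ^ Suc n) * of_real (exp (- (real (Suc n) * x)))"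
        by (simp only: sum_distrib_right mult.assoc)
      then show "(\<Sum>r<q. psi r * (E r * E r ^ n)) = \<tau> * (chi (Suc n) * of_real (exp (- (real (Suc n) * x))))"
        by (simp only: gauss mult.assoc[symmetric])
    qed
    finally have sums: "(\<lambda>n. \<tau> * (chi (Suc n) * of_real (exp (- (real (Suc n) * x))))) sums (\<Sum>r<q. psi r * (E r / (1 - E r)))"
      by simp
    show ?thesis
    proof (cases "\<tau> = 0")
      case True
      then show ?thesis using sums by (simp add: sums_iff)
    next
      case False
      then show ?thesis using sums_mult_D[OF sums] by (simp add: sums_iff)
    qed
  qed
  finally show ?thesis unfolding eq .
qed

text \<open>For \<open>Re s \<le> 1\<close> the series of integrals need not converge absolutely, so
  the interchange uses dominated convergence of partial sums: they are bounded by
  \<open>A * exp (- x)\<close> for every \<open>N\<close>.\<close>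

lemma mellin_character_exp:
  fixes a :: "nat \<Rightarrow> complex"
  assumes A: "\<And>n. norm (\<Sum>k<n. a (Suc k)) \<le> A" and s: "Re s > 0"
    and L: "(\<lambda>n. a (Suc n) / of_nat (Suc n) powr s) sums L"
  shows "((\<lambda>x. of_real x powr (s - 1) * (\<Sum>n. a (Suc n) * of_real (exp (- (real (Suc n) * x))))) has_integral Gamma s * L) {0<..}"
proof -
  define F where "F = (\<lambda>N x. of_real x powr (s - 1) * (\<Sum>n<N. a (Suc n) * of_real (exp (- (real (Suc n) * x)))))"
  define h where "h = (\<lambda>x. A * norm (complex_of_real x powr (s - 1) * of_real (exp (- (1 * x)))))"
  show ?thesis
  proof (rule has_integral_dominated_convergence[of F])
    show "(F N has_integral (\<Sum>n<N. Gamma s * (a (Suc n) / of_nat (Suc n) powr s))) {0<..}" for N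
    proof -
      have "((\<lambda>x. \<Sum>n<N. a (Suc n) * (of_real x powr (s - 1) * of_real (exp (- (real (Suc n) * x)))))
              has_integral (\<Sum>n<N. a (Suc n) * (Gamma s / of_real (real (Suc n)) powr s))) {0<..}"
        by (intro has_integral_sum has_integral_mult_right mellin_exp s) auto
      moreover have "F N = (\<lambda>x. \<Sum>n<N. a (Suc n) * (of_real x powr (s - 1) * of_real (exp (- (real (Suc n) * x)))))"
        by (simp only: F_def sum_distrib_left mult.left_commute)
      ultimately show ?thesis by (simp add: mult_ac)
    qed
    have "(\<lambda>x. norm (complex_of_real x powr (s - 1) * of_real (exp (- (1 * x))))) integrable_on {0<..}"
      using mellin_exp(1)[OF s zero_less_one] unfolding absolutely_integrable_on_def by (rule conjunct2)
    then show "h integrable_on {0<..}"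
      unfolding h_def by (rule integrable_on_mult_right)
    show "\<forall>x\<in>{0<..}. norm (F N x) \<le> h x" for N
    proof
      fix x :: real assume "x \<in> {0<..}"
      then have "norm (\<Sum>n<N. a (Suc n) * of_real (exp (- (real (Suc n) * x)))) \<le> A * exp (- x)"
        using exp_partial_sum_bound[of a A x N, OF A] by simp
      then have "norm (of_real x powr (s - 1)) * norm (\<Sum>n<N. a (Suc n) * of_real (exp (- (real (Suc n) * x))))
          \<le> norm (of_real x powr (s - 1)) * (A * exp (- x))"
        by (rule mult_left_mono) simp
      then show "norm (F N x) \<le> h x"
        by (simp add: F_def h_def norm_mult mult_ac)
    qed
    show "\<forall>x\<in>{0<..}. (\<lambda>N. F N x) \<longlonglongrightarrow> of_real x powr (s - 1) * (\<Sum>n. a (Suc n) * of_real (exp (- (real (Suc n) * x))))"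
    proof
      fix x :: real assume x: "x \<in> {0<..}"
      \<comment> \<open>A single coefficient is the difference of two bounded partial sums.\<close>
      have a: "norm (a (Suc n)) \<le> 2 * A" for n
      proof -
        have "a (Suc n) = (\<Sum>k<Suc n. a (Suc k)) - (\<Sum>k<n. a (Suc k))" by simp
        then have "norm (a (Suc n)) \<le> norm (\<Sum>k<Suc n. a (Suc k)) + norm (\<Sum>k<n. a (Suc k))"
          by (metis norm_triangle_ineq4)
        with A[of "Suc n"] A[of n] show ?thesis by linarith
      qed
      have "summable (\<lambda>n. a (Suc n) * of_real (exp (- (real (Suc n) * x))))"
      proof (rule summable_comparison_test)
        have "summable (\<lambda>n. exp (- x) ^ n)" using x by (intro summable_geometric) auto
        then show "summable (\<lambda>n. 2 * A * exp (- x) ^ Suc n)"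
          by (intro summable_mult) (simp add: summable_mult)
        have "norm (a (Suc n) * of_real (exp (- (real (Suc n) * x)))) \<le> 2 * A * exp (- x) ^ Suc n" for n
        proof -
          have e: "exp (- (real (Suc n) * x)) = exp (- x) ^ Suc n"
            by (simp only: exp_of_nat_mult[symmetric]) simp
          have "norm (a (Suc n) * of_real (exp (- (real (Suc n) * x)))) = norm (a (Suc n)) * exp (- (real (Suc n) * x))"
            by (simp add: norm_mult)
          also have "\<dots> = norm (a (Suc n)) * exp (- x) ^ Suc n" by (simp only: e)
          also have "\<dots> \<le> 2 * A * exp (- x) ^ Suc n"
            by (rule mult_right_mono[OF a]) simp
          finally show ?thesis .
        qed
        then show "\<exists>N. \<forall>n\<ge>N. norm (a (Suc n) * of_real (exp (- (real (Suc n) * x)))) \<le> 2 * A * exp (- x) ^ Suc n"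
          by blast
      qed
      then show "(\<lambda>N. F N x) \<longlonglongrightarrow> of_real x powr (s - 1) * (\<Sum>n. a (Suc n) * of_real (exp (- (real (Suc n) * x))))"
        unfolding F_def by (intro tendsto_intros) (rule summable_LIMSEQ)
    qed
    show "(\<lambda>N. \<Sum>n<N. Gamma s * (a (Suc n) / of_nat (Suc n) powr s)) \<longlonglongrightarrow> Gamma s * L"
      using sums_mult[OF L, of "Gamma s"] by (simp add: sums_def)
  qed
qed

text \<open>The kernel is homogeneous of degree -1 in \<open>(x, \<alpha>)\<close>, so the
  substitution \<open>x = \<alpha> * u\<close> extracts \<open>\<alpha> powr (s - 1)\<close>. With
  \<alpha> proportional to \<open>k\<close>, this power is the term \<open>k powr - (1 - s)\<close>
  of the reflected L-series.\<close>

lemma mellin_scaled_kernel: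
  assumes s: "0 < Re s" "Re s < 1" and \<epsilon>: "\<epsilon> = 1 \<or> \<epsilon> = -1"
  obtains K where "K \<noteq> 0"
    "\<And>\<alpha>. \<alpha> > 0 \<Longrightarrow> ((\<lambda>x. of_real x powr (s - 1) * (1 / (of_real x - \<i> * of_real \<alpha>) + \<epsilon> / (of_real x + \<i> * of_real \<alpha>)))
        has_integral K * of_real \<alpha> powr (s - 1)) {0<..}"
proof -
  define k where "k = (\<lambda>u::real. 1 / (of_real u - \<i>) + \<epsilon> / (of_real u + \<i>))"
  define K where "K = integral {0<..} (\<lambda>u. of_real u powr (s - 1) * k u)"
  have ai: "(\<lambda>u. of_real u powr (s - 1) * k u) absolutely_integrable_on {0<..}" and K: "K \<noteq> 0"
    unfolding K_def k_def using mellin_kernel[OF s \<epsilon>] by auto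
  show ?thesis
  proof (rule that[OF K])
    fix \<alpha> :: real assume \<alpha>: "\<alpha> > 0"
    note sc = mellin_scale[OF ai, of "1 / \<alpha>"]
    have "((\<lambda>u. of_real u powr (s - 1) * k (1 / \<alpha> * u)) has_integral K / of_real (1 / \<alpha>) powr s) {0<..}"
      using sc \<alpha> set_lebesgue_integral_eq_integral(1)[OF sc(1)] unfolding K_def by (simp add: has_integral_iff)
    from has_integral_mult_right[OF this, of "1 / of_real \<alpha>"]
    have "((\<lambda>u. 1 / of_real \<alpha> * (of_real u powr (s - 1) * k (1 / \<alpha> * u))) has_integral 1 / of_real \<alpha> * (K / of_real (1 / \<alpha>) powr s)) {0<..}" .
    moreover have "1 / of_real \<alpha> * (K / of_real (1 / \<alpha>) powr s) = K * of_real \<alpha> powr (s - 1)"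
    proof -
      have "of_real (1 / \<alpha>) powr s * of_real \<alpha> powr s = (of_real (1 / \<alpha>) * of_real \<alpha>) powr s"
        using \<alpha> by (intro powr_times_real[symmetric]) auto
      also have "\<dots> = 1" using \<alpha> by simp
      finally have "K / of_real (1 / \<alpha>) powr s = K * of_real \<alpha> powr s"
        using \<alpha> by (simp only: divide_eq_eq mult.assoc) (auto simp: mult.commute)
      then show ?thesis using \<alpha> by (simp only: powr_diff) simp
    qed
    moreover have "1 / of_real \<alpha> * (of_real u powr (s - 1) * k (1 / \<alpha> * u))
        = of_real u powr (s - 1) * (1 / (of_real u - \<i> * of_real \<alpha>) + \<epsilon> / (of_real u + \<i> * of_real \<alpha>))" for u
    proof -
      have 1: "of_real \<alpha> * (of_real (1 / \<alpha> * u) - \<i>) = of_real u - \<i> * of_real \<alpha>"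
       and 2: "of_real \<alpha> * (of_real (1 / \<alpha> * u) + \<i>) = of_real u + \<i> * of_real \<alpha>"
        using \<alpha> by (simp_all add: field_simps)
      have "1 / of_real \<alpha> * k (1 / \<alpha> * u) = 1 / (of_real u - \<i> * of_real \<alpha>) + \<epsilon> / (of_real u + \<i> * of_real \<alpha>)"
        unfolding k_def 1[symmetric] 2[symmetric] by (simp add: distrib_left)
      then show ?thesis by (simp only: mult.left_commute[of "1 / of_real \<alpha>"])
    qed
    ultimately show "((\<lambda>x. of_real x powr (s - 1) * (1 / (of_real x - \<i> * of_real \<alpha>) + \<epsilon> / (of_real x + \<i> * of_real \<alpha>)))
        has_integral K * of_real \<alpha> powr (s - 1)) {0<..}"
      by (simp only:)
  qed
qed

text \<open>The integrals of \<open>G J\<close> have two descriptions: termwise they are constant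
  multiples of partial sums for \<open>L(1-s,cnj chi)\<close>, and their limit is
  \<open>\<tau> * Gamma s * L(s,chi)\<close>. The zero makes that limit 0 for every \<tau>, and the
  constant \<open>K * b powr (s - 1)\<close> can be divided out.\<close>

lemma separable_L_zero_reflection:
  assumes chi: "dirichlet_character q chi" and q: "q > 1" and c: "coprime c q" "chi c \<noteq> 1"
    and gauss: "\<And>n. (\<Sum>r<q. cnj (chi r) * cis (2 * pi * (real r / real q)) ^ n) = \<tau> * chi n"
    and s: "0 < Re s" "Re s < 1" and zero: "dirichlet_series chi s = 0"
  shows "dirichlet_series (\<lambda>n. cnj (chi n)) (1 - s) = 0"
proof -
  define psi where "psi = (\<lambda>n. cnj (chi n))"
  have psi: "dirichlet_character q psi" unfolding psi_def by (rule dirichlet_character_cnj[OF chi])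
  have c': "psi c \<noteq> 1" using c by (simp add: psi_def)
  have q0: "q > 0" using q by simp
  have bound: "norm (\<Sum>k<n. f (Suc k)) \<le> real q" if "f = chi \<or> f = psi" for f n
    using dirichlet_character_partial_sum[OF chi q0 c, of n] dirichlet_character_partial_sum[OF psi q0 c(1) c', of n] that
    by (cases "n = 0") auto
  define b where "b = 2 * pi / real q"
  have b: "b > 0" using q by (simp add: b_def)
  define \<epsilon> where "\<epsilon> = psi (q - 1)"
  have \<epsilon>: "\<epsilon> = 1 \<or> \<epsilon> = -1" unfolding \<epsilon>_def by (rule dirichlet_character_minus_1[OF psi q])
  define \<Phi> where "\<Phi> = (\<lambda>x::real. \<Sum>n. chi (Suc n) * of_real (exp (- (real (Suc n) * x))))"
  define G where "G = (\<lambda>J x. of_real x powr (s - 1) * (\<Sum>k<J * q. psi (Suc k) * (1 / (of_real x - \<i> * of_real (b * real (Suc k)))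
                                + \<epsilon> / (of_real x + \<i> * of_real (b * real (Suc k))))))"
  obtain K where K: "K \<noteq> 0"
    "\<And>\<alpha>. \<alpha> > 0 \<Longrightarrow> ((\<lambda>x. of_real x powr (s - 1) * (1 / (of_real x - \<i> * of_real \<alpha>) + \<epsilon> / (of_real x + \<i> * of_real \<alpha>)))
        has_integral K * of_real \<alpha> powr (s - 1)) {0<..}"
    using mellin_scaled_kernel[OF s \<epsilon>] by blast
  \<comment> \<open>Any value strictly between \<open>Re s\<close> and 1 would do. The kernel bound
    with exponent 0 gives \<open>x powr (Re s - 1)\<close>, integrable at 0; with exponent
    \<open>p\<close> it gives \<open>x powr (Re s - 1 - p)\<close>, integrable at infinity.\<close>
  define p where "p = (Re s + 1) / 2"
  have p: "0 \<le> p" "p < 1" "Re s < p" using s by (auto simp: p_def)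
  have "\<exists>K. \<forall>x n. x > 0 \<longrightarrow> norm (\<Sum>k<n. psi (Suc k) / (of_real x - \<i> * of_real (b' * real (Suc k)))) \<le> K * x powr (- p')"
    if "b' \<noteq> 0" "0 \<le> p'" "p' < 1" for b' p'
    by (rule kernel_partial_sum_bound[of psi "real q" b' p']) (use bound that in auto)
  note ex = this
  \<comment> \<open>Four constants are required, for the two halves \<open>b\<close> and
    \<open>-b\<close> of the kernel and the two exponents 0 and \<open>p\<close>; a choice function
    names them all.\<close>
  define B where "B = (\<lambda>b' p'. SOME K. \<forall>x n. x > 0 \<longrightarrow> norm (\<Sum>k<n. psi (Suc k) / (of_real x - \<i> * of_real (b' * real (Suc k)))) \<le> K * x powr (- p'))"
  have B: "\<And>b' p' x n. b' \<noteq> 0 \<Longrightarrow> 0 \<le> p' \<Longrightarrow> p' < 1 \<Longrightarrow> x > 0 \<Longrightarrow>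
      norm (\<Sum>k<n. psi (Suc k) / (of_real x - \<i> * of_real (b' * real (Suc k)))) \<le> B b' p' * x powr (- p')"
    using someI_ex[OF ex] unfolding B_def by blast
  define C where "C = max (B b 0 + B (-b) 0) (B b p + B (-b) p)"
  define h where "h = (\<lambda>x. C * min (x powr (Re s - 1)) (x powr (Re s - 1 - p)))"
  have G_bound: "norm (G J x) \<le> h x" if x: "x > 0" for J x
  proof -
    let ?S = "\<lambda>b. \<Sum>k<J * q. psi (Suc k) / (of_real x - \<i> * of_real (b * real (Suc k)))"
    have split: "(\<Sum>k<J * q. psi (Suc k) * (1 / (of_real x - \<i> * of_real (b * real (Suc k))) + \<epsilon> / (of_real x + \<i> * of_real (b * real (Suc k)))))
        = ?S b + \<epsilon> * ?S (- b)"
    proof -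
      have neg: "of_real x - \<i> * of_real (- b * real (Suc k)) = of_real x + \<i> * of_real (b * real (Suc k))" for k by simp
      show ?thesis
        unfolding neg sum_distrib_left sum.distrib[symmetric] by (intro sum.cong refl) (simp add: distrib_left)
    qed
    have \<epsilon>1: "norm \<epsilon> = 1" using \<epsilon> by auto
    have "norm (?S b + \<epsilon> * ?S (- b)) \<le> norm (?S b) + norm (?S (- b))"
      using norm_triangle_ineq[of "?S b" "\<epsilon> * ?S (- b)"] \<epsilon>1 by (simp add: norm_mult)
    then have *: "norm (?S b + \<epsilon> * ?S (- b)) \<le> C * x powr (- p')" if "p' = 0 \<or> p' = p" for p'
    proof -
      have "norm (?S b) \<le> B b p' * x powr (- p')"
        by (rule B) (use that p b x in auto)
      moreover have "norm (?S (- b)) \<le> B (- b) p' * x powr (- p')"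
        by (rule B) (use that p b x in auto)
      ultimately have "norm (?S b) + norm (?S (- b)) \<le> (B b p' + B (- b) p') * x powr (- p')"
        by (simp add: distrib_right)
      also have "\<dots> \<le> C * x powr (- p')"
        using that by (intro mult_right_mono) (auto simp: C_def)
      finally show ?thesis using \<open>norm (?S b + \<epsilon> * ?S (- b)) \<le> norm (?S b) + norm (?S (- b))\<close> by linarith
    qed
    have "norm (G J x) = x powr (Re s - 1) * norm (?S b + \<epsilon> * ?S (- b))"
      unfolding G_def split using x by (simp add: norm_mult norm_powr_real_powr)
    moreover have "x powr (Re s - 1) * norm (?S b + \<epsilon> * ?S (- b)) \<le> C * x powr (Re s - 1 - p')" if "p' = 0 \<or> p' = p" for p'
    proof -
      have "x powr (Re s - 1) * norm (?S b + \<epsilon> * ?S (- b)) \<le> x powr (Re s - 1) * (C * x powr (- p'))"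
        by (intro mult_left_mono *[OF that]) auto
      also have "\<dots> = C * (x powr (Re s - 1) * x powr (- p'))" by (simp only: mult.left_commute)
      also have "x powr (Re s - 1) * x powr (- p') = x powr (Re s - 1 - p')"
        by (simp flip: powr_add)
      finally show ?thesis .
    qed
    from this[of 0] this[of p] have "x powr (Re s - 1) * norm (?S b + \<epsilon> * ?S (- b)) \<le> h x"
      by (auto simp: h_def min_def)
    ultimately show ?thesis by simp
  qed
  have G_int: "(G J has_integral K * of_real b powr (s - 1) * (\<Sum>k<J * q. psi (Suc k) / of_nat (Suc k) powr (1 - s))) {0<..}" for J
  proof -
    have "((\<lambda>x. \<Sum>k<J * q. psi (Suc k) * (of_real x powr (s - 1) * (1 / (of_real x - \<i> * of_real (b * real (Suc k)))
                                + \<epsilon> / (of_real x + \<i> * of_real (b * real (Suc k))))))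
        has_integral (\<Sum>k<J * q. psi (Suc k) * (K * of_real (b * real (Suc k)) powr (s - 1)))) {0<..}"
      using b by (intro has_integral_sum has_integral_mult_right K(2)) auto
    moreover have "G J = (\<lambda>x. \<Sum>k<J * q. psi (Suc k) * (of_real x powr (s - 1) * (1 / (of_real x - \<i> * of_real (b * real (Suc k)))
                                + \<epsilon> / (of_real x + \<i> * of_real (b * real (Suc k))))))"
      by (simp only: G_def sum_distrib_left mult.left_commute)
    moreover have "psi (Suc k) * (K * of_real (b * real (Suc k)) powr (s - 1))
        = K * of_real b powr (s - 1) * (psi (Suc k) / of_nat (Suc k) powr (1 - s))" for k
    proof -
      have "of_real (b * real (Suc k)) powr (s - 1) = of_real b powr (s - 1) * of_nat (Suc k) powr (s - 1)"
        using b powr_times_real[of "of_real b" "of_real (real (Suc k))" "s - 1"] by simp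
      moreover have "of_nat (Suc k) powr (s - 1) = 1 / of_nat (Suc k) powr (1 - s)"
        using powr_minus_divide[of "of_nat (Suc k)" "1 - s"] by simp
      ultimately show ?thesis by simp
    qed
    ultimately show ?thesis by (simp only: sum_distrib_left)
  qed
  have "(\<lambda>J. integral {0<..} (G J)) \<longlonglongrightarrow> integral {0<..} (\<lambda>x. of_real x powr (s - 1) * (\<tau> * \<Phi> x))"
  proof (rule dominated_convergence(2)[of G "{0<..}" h])
    show "G J integrable_on {0<..}" for J using G_int by blast
    show "h integrable_on {0<..}"
      unfolding h_def using s p by (intro integrable_on_mult_right integrable_min_powr) auto
    show "norm (G J x) \<le> h x" if "x \<in> {0<..}" for J x using G_bound that by simp
    show "(\<lambda>J. G J x) \<longlonglongrightarrow> of_real x powr (s - 1) * (\<tau> * \<Phi> x)" if "x \<in> {0<..}" for x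
      unfolding G_def \<Phi>_def \<epsilon>_def b_def using that gauss
      by (intro tendsto_mult tendsto_const character_kernel_limit[OF psi q c(1) c']) (auto simp: psi_def)
  qed
  also have "integral {0<..} (\<lambda>x. of_real x powr (s - 1) * (\<tau> * \<Phi> x)) = \<tau> * (Gamma s * 0)"
  proof -
    have "(\<lambda>n. chi (Suc n) / of_nat (Suc n) powr s) sums 0"
      using dirichlet_L_sums[OF chi q0 c s(1)] zero by simp
    then have "((\<lambda>x. of_real x powr (s - 1) * \<Phi> x) has_integral Gamma s * 0) {0<..}"
      unfolding \<Phi>_def using bound s(1) by (intro mellin_character_exp) auto
    from integral_unique[OF has_integral_mult_right[OF this, of \<tau>]] show ?thesis
      by (simp only: mult.left_commute)
  qed
  finally have "(\<lambda>J. K * of_real b powr (s - 1) * (\<Sum>k<J * q. psi (Suc k) / of_nat (Suc k) powr (1 - s))) \<longlonglongrightarrow> 0"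
    unfolding integral_unique[OF G_int] by (simp only: mult_zero_right)
  moreover have "(\<lambda>J. K * of_real b powr (s - 1) * (\<Sum>k<J * q. psi (Suc k) / of_nat (Suc k) powr (1 - s)))
      \<longlonglongrightarrow> K * of_real b powr (s - 1) * dirichlet_series psi (1 - s)"
  proof (intro tendsto_mult tendsto_const)
    have "(\<lambda>N. \<Sum>k<N. psi (Suc k) / of_nat (Suc k) powr (1 - s)) \<longlonglongrightarrow> dirichlet_series psi (1 - s)"
      using dirichlet_L_sums[OF psi q0 c(1) c', of "1 - s"] s unfolding sums_def by simp
    \<comment> \<open>The folding onto residues needs whole blocks of length \<open>q\<close>; the
      limit along multiples of \<open>q\<close> is that of the convergent L-series.\<close>
    moreover have "filterlim (\<lambda>J. J * q) sequentially sequentially"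
      using q by (intro filterlim_at_top_mono[OF filterlim_ident]) auto
    ultimately show "(\<lambda>J. \<Sum>k<J * q. psi (Suc k) / of_nat (Suc k) powr (1 - s)) \<longlonglongrightarrow> dirichlet_series psi (1 - s)"
      by (rule filterlim_compose)
  qed
  ultimately have "K * of_real b powr (s - 1) * dirichlet_series psi (1 - s) = 0"
    by (rule LIMSEQ_unique[symmetric])
  then show ?thesis using K(1) b by (simp add: psi_def)
qed

section \<open>Primitive characters\<close>

text \<open>Take \<open>m = n + d * j\<close> with \<open>j\<close> the product of the primes
  dividing \<open>q\<close> but not \<open>n\<close>. Every prime factor of \<open>q\<close> then
  divides exactly one of \<open>n\<close> and \<open>d * j\<close>: if it divides \<open>n\<close>,
  it divides neither \<open>d\<close> nor \<open>j\<close>.\<close>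

lemma coprime_lift:
  fixes n d q :: nat
  assumes q: "q > 0" and n: "coprime n d"
  obtains m where "coprime m q" "[m = n] (mod d)"
proof -
  define j where "j = \<Prod>{p \<in> prime_factors q. \<not> p dvd n}"
  have fin: "finite {p \<in> prime_factors q. \<not> p dvd n}" by simp
  have "coprime (n + d * j) q"
  proof (rule ccontr)
    assume "\<not> coprime (n + d * j) q"
    then have "gcd (n + d * j) q \<noteq> 1" by (simp only: coprime_iff_gcd_eq_1 not_False_eq_True)
    then obtain p where "prime p" "p dvd gcd (n + d * j) q" using prime_factor_nat by blast
    then have p: "prime p" "p dvd n + d * j" "p dvd q" using dvd_trans gcd_dvd1 gcd_dvd2 by blast+
    show False
    proof (cases "p dvd n")
      case True
      then have "\<not> p dvd d" using coprime_common_divisor[OF n True] p(1) not_prime_unit by blast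
      moreover have "p dvd d * j" using p(2) dvd_add_right_iff[OF True, of "d * j"] by simp
      ultimately have "p dvd j" using p(1) by (simp add: prime_dvd_mult_iff)
      then obtain r where "r \<in> {p \<in> prime_factors q. \<not> p dvd n}" "p dvd r"
        unfolding j_def using prime_dvd_prod_iff[OF fin p(1), of "\<lambda>x. x"] by auto
      then have "prime r" "\<not> r dvd n" by auto
      then have "p = r" using p(1) \<open>p dvd r\<close> by (metis primes_dvd_imp_eq)
      then show False using True \<open>\<not> r dvd n\<close> by simp
    next
      case False
      then have "p \<in> {p \<in> prime_factors q. \<not> p dvd n}" using p q by (auto simp: in_prime_factors_iff)
      then have "p dvd j" unfolding j_def by (rule dvd_prod_eqI[OF fin _ refl])
      then have "p dvd n" using p(2) dvd_add_left_iff[of p "d * j" n] by simp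
      then show False using False by simp
    qed
  qed
  moreover have "[n + d * j = n] (mod d)" by (simp add: cong_def)
  ultimately show ?thesis using that by blast
qed

text \<open>Stated through witnesses: for each proper divisor \<open>e\<close> some unit congruent
  to 1 modulo \<open>e\<close> has value different from 1. Such a unit is what forces a Gauss sum at
  a non-unit to vanish.\<close>

definition primitive_character :: "nat \<Rightarrow> (nat \<Rightarrow> complex) \<Rightarrow> bool" where
  "primitive_character d chi \<longleftrightarrow> dirichlet_character d chi \<and>
     (\<forall>e. e dvd d \<and> e < d \<longrightarrow> (\<exists>n. coprime n d \<and> [n = 1] (mod e) \<and> chi n \<noteq> 1))"

text \<open>The modulus \<open>d\<close> is the conductor, the least divisor of \<open>q\<close>
  such that \<open>chi\<close> is 1 on all units modulo \<open>q\<close> congruent to 1 modulo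
  \<open>d\<close>. Then \<open>chi\<close> depends only on the class modulo \<open>d\<close>, and
  minimality is primitivity.\<close>

lemma inducing_character:
  assumes chi: "dirichlet_character q chi" and q: "q > 0"
  obtains d chi' where "d dvd q" "primitive_character d chi'" "\<And>n. coprime n q \<Longrightarrow> chi' n = chi n"
proof -
  define I where "I = (\<lambda>d. d dvd q \<and> (\<forall>n. coprime n q \<and> [n = 1] (mod d) \<longrightarrow> chi n = 1))"
  define d where "d = (LEAST d. I d)"
  have "I q"
    unfolding I_def using dirichlet_character_cong[OF chi, of _ 1] dirichlet_character_1[OF chi] by auto
  then have Id: "I d" and least: "\<And>e. I e \<Longrightarrow> d \<le> e"
    unfolding d_def by (auto intro: LeastI Least_le)
  have dq: "d dvd q" using Id by (simp add: I_def)
  have well_defined: "chi m = chi m'" if m: "coprime m q" "coprime m' q" "[m = m'] (mod d)" for m m'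
  proof -
    \<comment> \<open>An inverse of \<open>m\<close> modulo \<open>q\<close>, by Euler's
      theorem.\<close>
    define i where "i = m ^ (totient q - 1)"
    have "m * i = m ^ totient q" using q unfolding i_def by (simp add: power_eq_if)
    then have mi: "[m * i = 1] (mod q)" using euler_theorem[OF m(1)] by simp
    have ci: "coprime i q" unfolding i_def using m(1) by simp
    have "[m' * i = m * i] (mod d)" using m(3) by (intro cong_mult cong_refl) (rule cong_sym)
    also have "[m * i = 1] (mod d)" using mi dq cong_dvd_modulus_nat by blast
    finally have "chi (m' * i) = 1" using Id m(2) ci by (simp add: I_def)
    moreover have "chi (m * i) = 1"
      using dirichlet_character_cong[OF chi mi] dirichlet_character_1[OF chi] by simp
    ultimately have "chi m' * chi i = chi m * chi i" by (simp add: dirichlet_character_mult[OF chi])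
    moreover have "chi i \<noteq> 0" using ci dirichlet_character_eq_0_iff[OF chi] by simp
    ultimately show ?thesis by simp
  qed
  \<comment> \<open>A unit modulo \<open>d\<close> may share factors with \<open>q\<close>, so
    \<open>chi\<close> is evaluated at a representative coprime to \<open>q\<close>;
    \<open>well_defined\<close> makes the choice immaterial.\<close>
  define chi' where "chi' = (\<lambda>n. if coprime n d then chi (SOME m. coprime m q \<and> [m = n] (mod d)) else 0)"
  have chi'_eq: "chi' n = chi m" if "coprime m q" "[m = n] (mod d)" for m n
  proof -
    have "coprime m d" using that(1) dq by (meson coprime_divisors dvd_refl)
    then have "coprime n d" using that(2) by (simp add: cong_imp_coprime)
    define m' where "m' = (SOME m. coprime m q \<and> [m = n] (mod d))"
    have m': "coprime m' q \<and> [m' = n] (mod d)"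
      unfolding m'_def by (rule someI_ex) (use that in blast)
    then have "[m' = m] (mod d)" using cong_trans[OF _ cong_sym[OF that(2)]] by blast
    then have "chi m' = chi m" using m' that(1) by (intro well_defined) auto
    then show ?thesis using \<open>coprime n d\<close> by (simp add: chi'_def m'_def)
  qed
  have lift: "\<exists>m. coprime m q \<and> [m = n] (mod d)" if "coprime n d" for n
    by (rule coprime_lift[OF q that]) blast
  have chi': "dirichlet_character d chi'"
    unfolding dirichlet_character_def
  proof (intro conjI allI)
    fix m n
    show "chi' (m * n) = chi' m * chi' n"
    proof (cases "coprime m d \<and> coprime n d")
      case True
      then obtain m' n' where *: "coprime m' q" "[m' = m] (mod d)" "coprime n' q" "[n' = n] (mod d)"
        using lift[of m] lift[of n] by blast
      have "coprime (m' * n') q" using *(1,3) by simp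
      then have "chi' (m * n) = chi (m' * n')" using cong_mult[OF *(2,4)] by (rule chi'_eq)
      also have "\<dots> = chi' m * chi' n"
        using chi'_eq[OF *(1,2)] chi'_eq[OF *(3,4)] by (simp add: dirichlet_character_mult[OF chi])
      finally show ?thesis .
    qed (auto simp: chi'_def)
    show "chi' (n + d) = chi' n"
    proof (cases "coprime n d")
      case True
      then obtain m where m: "coprime m q" "[m = n] (mod d)" using lift by blast
      moreover have "[m = n + d] (mod d)" using m(2) by (simp add: cong_def)
      ultimately show ?thesis using chi'_eq[of m n] chi'_eq[of m "n + d"] by simp
    next
      case False
      moreover have "coprime (n + d) d \<longleftrightarrow> coprime n d" by (simp only: coprime_iff_gcd_eq_1 gcd_add1)
      ultimately show ?thesis by (simp add: chi'_def)
    qed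
    show "(chi' n \<noteq> 0) = coprime n d"
    proof (cases "coprime n d")
      case True
      then obtain m where m: "coprime m q" "[m = n] (mod d)" using lift by blast
      then show ?thesis using True chi'_eq[OF m] dirichlet_character_eq_0_iff[OF chi] by simp
    qed (simp add: chi'_def)
    show "chi' 1 = 1" using chi'_eq[of 1 1] dirichlet_character_1[OF chi] by simp
  qed
  have ext: "chi' n = chi n" if "coprime n q" for n using chi'_eq[OF that] by simp
  have "\<exists>n. coprime n d \<and> [n = 1] (mod e) \<and> chi' n \<noteq> 1" if "e dvd d" "e < d" for e
  proof -
    have "\<not> I e" using least[of e] that by auto
    moreover have "e dvd q" using that dq by (rule_tac dvd_trans)
    ultimately obtain n where n: "coprime n q" "[n = 1] (mod e)" "chi n \<noteq> 1" by (auto simp: I_def)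
    have "coprime n d" using n(1) dq by (meson coprime_divisors dvd_refl)
    then show ?thesis using n ext by auto
  qed
  then have "primitive_character d chi'" using chi' by (simp add: primitive_character_def)
  then show ?thesis using that dq ext by blast
qed

text \<open>Separability of the Gauss sums. For \<open>n\<close> coprime to \<open>d\<close>,
  reindexing \<open>r\<close> by \<open>n * r\<close> extracts the character value. Otherwise, with
  \<open>g = gcd n d\<close>, primitivity gives a unit \<open>a\<close> congruent to 1 modulo
  \<open>d div g\<close> with \<open>chi a \<noteq> 1\<close>; as \<open>a * n\<close> and
  \<open>n\<close> agree modulo \<open>d\<close>, the sum equals \<open>cnj (chi a)\<close> times
  itself and is 0.\<close>

lemma primitive_character_gauss_sum:
  assumes prim: "primitive_character d chi" and d: "d > 0"
  shows "(\<Sum>r<d. cnj (chi r) * cis (2 * pi * (real r / real d)) ^ n)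
           = (\<Sum>r<d. cnj (chi r) * cis (2 * pi * (real r / real d))) * chi n"
proof -
  have chi: "dirichlet_character d chi" using prim by (simp add: primitive_character_def)
  define w where "w = cis (2 * pi / real d)"
  have wd: "w ^ d = 1" unfolding w_def Complex.DeMoivre using d by simp
  have w_cong: "w ^ a = w ^ b" if "[a = b] (mod d)" for a b
  proof -
    have "w ^ a = w ^ (a mod d)" for a
    proof -
      have "w ^ a = w ^ (a div d * d + a mod d)" by simp
      also have "\<dots> = (w ^ d) ^ (a div d) * w ^ (a mod d)"
        by (simp only: power_add power_mult mult.commute[of "a div d"])
      finally show ?thesis by (simp add: wd)
    qed
    from this[of a] this[of b] show ?thesis using that by (simp only: cong_def)
  qed
  define S where "S = (\<lambda>n. \<Sum>r<d. cnj (chi r) * w ^ (r * n))"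
  have cis_eq: "cis (2 * pi * (real r / real d)) ^ n = w ^ (r * n)" for r n
    unfolding w_def Complex.DeMoivre by (simp add: field_simps)
  have S_eq: "(\<Sum>r<d. cnj (chi r) * cis (2 * pi * (real r / real d)) ^ n) = S n" for n
    unfolding S_def cis_eq ..
  have shift: "S n = cnj (chi a) * (\<Sum>r<d. cnj (chi r) * w ^ (a * r * n))" if "coprime a d" for a n
  proof -
    have "S n = (\<Sum>r<d. cnj (chi ((a * r) mod d)) * w ^ ((a * r) mod d * n))"
      unfolding S_def by (rule sum.reindex_bij_betw[OF bij_betw_mult_mod[OF that d], symmetric])
    also have "\<dots> = (\<Sum>r<d. cnj (chi a) * (cnj (chi r) * w ^ (a * r * n)))"
    proof (intro sum.cong refl)
      fix r
      have "w ^ ((a * r) mod d * n) = w ^ (a * r * n)"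
        by (intro w_cong cong_mult cong_refl) (simp add: cong_def)
      then show "cnj (chi ((a * r) mod d)) * w ^ ((a * r) mod d * n) = cnj (chi a) * (cnj (chi r) * w ^ (a * r * n))"
        by (simp add: dirichlet_character_mod[OF chi] dirichlet_character_mult[OF chi])
    qed
    finally show ?thesis by (simp add: sum_distrib_left)
  qed
  have "S n = S 1 * chi n"
  proof (cases "coprime n d")
    case True
    have "S 1 = cnj (chi n) * (\<Sum>r<d. cnj (chi r) * w ^ (n * r * 1))" by (rule shift[OF True])
    also have "(\<Sum>r<d. cnj (chi r) * w ^ (n * r * 1)) = S n"
      by (simp add: S_def mult.commute)
    finally have "S 1 * chi n = (chi n * cnj (chi n)) * S n" by simp
    also have "chi n * cnj (chi n) = 1"
      using complex_norm_square[of "chi n"] dirichlet_character_norm[OF chi d True] by simp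
    finally show ?thesis by simp
  next
    case False
    define g where "g = gcd n d"
    have "g \<noteq> 1" using False by (simp only: g_def coprime_iff_gcd_eq_1 not_False_eq_True)
    moreover have g: "g dvd n" "g dvd d" "g > 0" using d by (auto simp: g_def)
    ultimately have "d div g < d" using d by (intro div_less_dividend) auto
    moreover have "d div g dvd d" using g by (metis dvd_div_mult_self dvd_triv_left)
    ultimately obtain a where a: "coprime a d" "[a = 1] (mod (d div g))" "chi a \<noteq> 1"
      using prim unfolding primitive_character_def by blast
    have "[a * n = n] (mod d)"
    proof -
      have "int (d div g) dvd int a - 1" using a(2) by (simp add: cong_iff_dvd_diff flip: cong_int_iff)
      then have "int (d div g) * int g dvd (int a - 1) * int n" using g(1) by (intro mult_dvd_mono) auto
      moreover have "int (d div g) * int g = int d" using g(2) by (simp flip: of_nat_mult)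
      ultimately have "int d dvd int (a * n) - int n" by (simp add: algebra_simps)
      then show ?thesis by (simp add: cong_iff_dvd_diff flip: cong_int_iff)
    qed
    then have "w ^ (a * r * n) = w ^ (r * n)" for r
      using cong_mult[OF cong_refl[of r], of "a * n" n d] by (intro w_cong) (simp add: mult_ac)
    then have "(\<Sum>r<d. cnj (chi r) * w ^ (a * r * n)) = S n"
      unfolding S_def by (intro sum.cong refl) (simp only:)
    then have "S n = cnj (chi a) * S n" using shift[OF a(1), of n] by (simp only:)
    then have "(1 - cnj (chi a)) * S n = 0" unfolding left_diff_distrib by (simp only: mult_1_left right_minus_eq)
    moreover have "1 - cnj (chi a) \<noteq> 0" using a(3) by simp
    ultimately have "S n = 0" by simp
    then show ?thesis using False dirichlet_character_eq_0_iff[OF chi] by simp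
  qed
  moreover have "(\<Sum>r<d. cnj (chi r) * cis (2 * pi * (real r / real d))) = S 1"
    using S_eq[of 1] by (simp only: power_one_right)
  ultimately show ?thesis by (simp only: S_eq)
qed

section \<open>Sums over primes and the main theorem\<close>

text \<open>For \<open>Re s > 1\<close> this is the sieve, as \<open>chi\<close> is
  \<open>chi'\<close> with the multiples of the prime factors of \<open>q\<close> removed;
  holomorphy carries it to \<open>Re s > 0\<close>. Primes dividing \<open>d\<close> contribute the
  factor 1, since \<open>chi'\<close> vanishes there.\<close>

lemma dirichlet_series_imprimitive:
  assumes chi: "dirichlet_character q chi" and q: "q > 0" and c: "coprime c q" "chi c \<noteq> 1"
    and chi': "dirichlet_character d chi'" and d: "d dvd q" and ext: "\<And>n. coprime n q \<Longrightarrow> chi' n = chi n"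
    and s: "Re s > 0"
  shows "dirichlet_series chi s = (\<Prod>p\<in>prime_factors q. 1 - chi' p / of_nat p powr s) * dirichlet_series chi' s"
proof -
  have d0: "d > 0" using d q by (auto intro: Nat.gr0I)
  have c': "coprime c d" "chi' c \<noteq> 1"
    using c d ext coprime_divisors[OF dvd_refl d] by auto
  let ?P = "\<lambda>s. \<Prod>p\<in>prime_factors q. 1 - chi' p / of_nat p powr s"
  have sieve: "(if \<exists>p\<in>prime_factors q. p dvd n then 0 else chi' n) = chi n" for n
  proof (cases "coprime n q")
    case True
    have "\<not> p dvd n" if "p \<in> prime_factors q" for p
      using that coprime_common_divisor[OF True, of p] not_prime_unit[of p]
      unfolding in_prime_factors_iff by blast
    then show ?thesis using ext[OF True] by auto
  next
    case False
    then have "gcd n q \<noteq> 1" by (simp only: coprime_iff_gcd_eq_1 not_False_eq_True)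
    then obtain p where p: "prime p" "p dvd gcd n q" using prime_factor_nat by blast
    then have "p dvd n" "p \<in> prime_factors q"
      using q dvd_trans[OF p(2) gcd_dvd1] dvd_trans[OF p(2) gcd_dvd2] by (auto simp: in_prime_factors_iff)
    then show ?thesis using False dirichlet_character_eq_0_iff[OF chi] by auto
  qed
  show ?thesis
  proof (rule analytic_continuation_open[of "{s. Re s > 1}" "{s. Re s > 0}" "dirichlet_series chi" "\<lambda>s. ?P s * dirichlet_series chi' s"])
    show "open {s. Re s > 1}" "open {s. Re s > 0}" by (rule open_halfspace_Re_gt)+
    have "2 \<in> {s. Re s > 1}" by simp
    then show "{s. Re s > 1} \<noteq> {}" by blast
    show "connected {s. Re s > 0}" by (intro convex_connected convex_halfspace_Re_gt)
    show "{s. Re s > 1} \<subseteq> {s. Re s > 0}" by auto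
    show "dirichlet_series chi holomorphic_on {s. Re s > 0}" by (rule dirichlet_L_holomorphic[OF chi q c])
    show "(\<lambda>s. ?P s * dirichlet_series chi' s) holomorphic_on {s. Re s > 0}"
      by (intro holomorphic_intros dirichlet_L_holomorphic[OF chi' d0 c']) (auto simp: prime_gt_0_nat)
    show "dirichlet_series chi z = ?P z * dirichlet_series chi' z" if "z \<in> {s. Re s > 1}" for z
    proof -
      have "dirichlet_series (\<lambda>n. if \<exists>p\<in>prime_factors q. p dvd n then 0 else chi' n) z = ?P z * dirichlet_series chi' z"
        by (rule dirichlet_series_sieve[OF dirichlet_character_mult[OF chi'] dirichlet_character_norm_le[OF chi' d0]])
           (use that in auto)
      then show ?thesis by (simp only: sieve)
    qed
  qed (use s in auto)
qed

lemma euler_factors_nonzero: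
  assumes "\<And>n. norm (a n :: complex) \<le> 1" "Re s > 0"
  shows "(\<Prod>p\<in>prime_factors q. 1 - a p / of_nat p powr s) \<noteq> 0"
proof -
  have "a p / of_nat p powr s \<noteq> 1" if "p \<in> prime_factors q" for p
    using norm_divide_powr_less_1[OF assms(1) _ assms(2), of p p] prime_ge_2_nat[OF in_prime_factors_imp_prime[OF that]] by auto
  then show ?thesis by (auto simp: prod_zero_iff)
qed

lemma dirichlet_L_zero_reflection:
  assumes chi: "dirichlet_character q chi" and q: "q > 0" and c: "coprime c q" "chi c \<noteq> 1"
    and s: "0 < Re s" "Re s < 1" and zero: "dirichlet_series chi s = 0"
  shows "dirichlet_series (\<lambda>n. cnj (chi n)) (1 - s) = 0"
proof -
  obtain d chi' where d: "d dvd q" and prim: "primitive_character d chi'" and ext: "\<And>n. coprime n q \<Longrightarrow> chi' n = chi n"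
    using inducing_character[OF chi q] by blast
  have chi': "dirichlet_character d chi'" using prim by (simp add: primitive_character_def)
  have d0: "d > 0" using d q by (auto intro: Nat.gr0I)
  have c': "coprime c d" "chi' c \<noteq> 1"
    using c d ext coprime_divisors[OF dvd_refl d] by auto
  \<comment> \<open>A character modulo 1 is constantly 1, which \<open>chi' c \<noteq> 1\<close>
    excludes; the reflection for primitive characters relies on a modulus greater than 1, so that
    the character vanishes at 0.\<close>
  have "d \<noteq> 1"
  proof
    assume "d = 1"
    then have "chi' c = chi' 1" using dirichlet_character_cong[OF chi', of c 1] by simp
    then show False using c'(2) dirichlet_character_1[OF chi'] by simp
  qed
  then have d1: "d > 1" using d0 by simp
  have "(\<Prod>p\<in>prime_factors q. 1 - chi' p / of_nat p powr s) \<noteq> 0"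
    using dirichlet_character_norm_le[OF chi' d0] s(1) by (rule euler_factors_nonzero)
  moreover have "(\<Prod>p\<in>prime_factors q. 1 - chi' p / of_nat p powr s) * dirichlet_series chi' s = 0"
    using dirichlet_series_imprimitive[OF chi q c chi' d ext s(1)] zero by (simp only:)
  ultimately have "dirichlet_series chi' s = 0" using mult_eq_0_iff by blast
  then have "dirichlet_series (\<lambda>n. cnj (chi' n)) (1 - s) = 0"
    by (rule separable_L_zero_reflection[OF chi' d1 c' primitive_character_gauss_sum[OF prim d0] s])
  moreover have "cnj (chi c) \<noteq> 1" "0 < Re (1 - s)" using c s by auto
  ultimately show ?thesis
    using dirichlet_series_imprimitive[OF dirichlet_character_cnj[OF chi] q c(1) _ dirichlet_character_cnj[OF chi'] d, of "1 - s"] ext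
    by simp
qed

text \<open>Translation from sums over primes up to \<open>n\<close> to sums over the first
  \<open>K\<close> primes, where \<open>K\<close> is the number of primes up to \<open>n\<close>.
  Only \<open>K \<le> n\<close> is exported, which suffices to carry over a bound increasing in the
  index.\<close>

lemma sum_primes_conv_nth_prime:
  fixes f :: "nat \<Rightarrow> real"
  obtains K where "K \<le> n" "(\<Sum>k<n. if prime (Suc k) then f (Suc k) else 0) = (\<Sum>i\<in>{1..K}. f (nth_prime i))"
proof -
  let ?S = "{p::nat. prime p}"
  have inf: "infinite ?S" by (rule primes_infinite)
  \<comment> \<open>\<open>enumerate\<close> starts at 0, so the index of the first prime beyond
    \<open>n\<close> is the number of primes up to \<open>n\<close>.\<close>
  define K where "K = (LEAST i. enumerate ?S i > n)"
  have "\<exists>i. enumerate ?S i > n" using le_enumerate[OF inf, of "Suc n"] by (auto intro!: exI[of _ "Suc n"])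
  then have K: "enumerate ?S K > n" and K_least: "\<And>i. i < K \<Longrightarrow> enumerate ?S i \<le> n"
    unfolding K_def by (auto intro: LeastI_ex dest: not_less_Least)
  have inj: "inj_on (enumerate ?S) {..<K}"
    using strict_mono_enumerate[OF inf] by (meson inj_on_subset strict_mono_imp_inj_on subset_UNIV)
  have img: "enumerate ?S ` {..<K} = {p. prime p \<and> p \<le> n}"
  proof (intro equalityI subsetI)
    fix p assume "p \<in> {p. prime p \<and> p \<le> n}"
    then have p: "p \<in> ?S" "p \<le> n" by auto
    obtain i where i: "enumerate ?S i = p" using enumerate_Ex[OF inf p(1)] by blast
    have "i < K"
    proof (rule ccontr)
      assume "\<not> i < K"
      then have "enumerate ?S K \<le> enumerate ?S i"
        using strict_mono_enumerate[OF inf] by (simp add: strict_mono_less_eq)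
      then show False using K i p by simp
    qed
    then show "p \<in> enumerate ?S ` {..<K}" using i by blast
  qed (use K_least enumerate_in_set[OF inf] in auto)
  show ?thesis
  proof (rule that[of K])
    have "K = card {p. prime p \<and> p \<le> n}" unfolding img[symmetric] using card_image[OF inj] by simp
    also have "\<dots> \<le> card {1..n}" by (intro card_mono) (auto dest: prime_ge_1_nat)
    finally show "K \<le> n" by simp
    have "(\<Sum>k<n. if prime (Suc k) then f (Suc k) else 0) = (\<Sum>k\<in>{1..n}. if prime k then f k else 0)"
      by (simp add: sum.atLeast1_atMost_eq)
    also have "\<dots> = (\<Sum>p\<in>{p. prime p \<and> p \<le> n}. f p)"
      by (intro sum.mono_neutral_cong_right) (auto dest: prime_ge_1_nat)
    also have "\<dots> = (\<Sum>i<K. f (enumerate ?S i))"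
      unfolding img[symmetric] by (simp add: sum.reindex[OF inj])
    also have "\<dots> = (\<Sum>i\<in>{1..K}. f (nth_prime i))"
      by (simp add: sum.atLeast1_atMost_eq nth_prime_def)
    finally show "(\<Sum>k<n. if prime (Suc k) then f (Suc k) else 0) = (\<Sum>i\<in>{1..K}. f (nth_prime i))" .
  qed
qed

section \<open>From the random hypothesis to deterministic bounds on prime sums\<close>

lemma nth_prime_prime: "prime (nth_prime n)"
  using enumerate_in_set[OF primes_infinite] by (simp add: nth_prime_def)

text \<open>At \<open>t = 0\<close> the summand is \<open>cos (- theta)\<close>, the real part of a
  number of norm 1 with argument \<open>theta\<close>. Primes dividing \<open>q\<close> have
  \<open>chi p = 0\<close> and may be restored. The right-hand side is free of
  \<open>m\<close>.\<close>

lemma B_rand_0: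
  assumes chi: "dirichlet_character q chi" and q: "q > 0"
  shows "B_rand q chi m 0 N = (\<Sum>n\<in>{1..N}. Re (chi (nth_prime n)))"
proof -
  have "B_rand q chi m 0 N = (\<Sum>n\<in>{n \<in> {1..N}. \<not> nth_prime n dvd q}. Re (chi (nth_prime n)))"
    unfolding B_rand_def
  proof (intro sum.cong refl)
    fix n assume "n \<in> {n \<in> {1..N}. \<not> nth_prime n dvd q}"
    then have "coprime (nth_prime n) q" using nth_prime_prime by (auto intro: prime_imp_coprime)
    then have "norm (chi (nth_prime n)) = 1" by (rule dirichlet_character_norm[OF chi q])
    then have "chi (nth_prime n) = cis (Arg (chi (nth_prime n)))"
      by (metis Arg_eq norm_zero zero_neq_one of_real_1 mult_1 cis_conv_exp)
    then show "cos (0 * ln (real (nth_prime n + m n * q)) - theta chi (nth_prime n)) = Re (chi (nth_prime n))"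
      unfolding theta_def by (metis cis.sel(1) cos_minus diff_0 mult_zero_left)
  qed
  also have "\<dots> = (\<Sum>n\<in>{1..N}. Re (chi (nth_prime n)))"
  proof (intro sum.mono_neutral_left ballI)
    fix n assume "n \<in> {1..N} - {n \<in> {1..N}. \<not> nth_prime n dvd q}"
    then have dvd: "nth_prime n dvd q" by auto
    have "\<not> coprime (nth_prime n) q"
      using coprime_common_divisor[of "nth_prime n" q "nth_prime n", OF _ dvd_refl dvd] not_prime_unit nth_prime_prime by blast
    then have "chi (nth_prime n) = 0" by (simp add: dirichlet_character_eq_0_iff[OF chi])
    then show "Re (chi (nth_prime n)) = 0" by simp
  qed auto
  finally show ?thesis .
qed

text \<open>The finitely many \<open>N < N0\<close> outside the range of the eventual bound satisfy
  \<open>\<bar>S N\<bar> \<le> N0\<close>, and \<open>N powr \<theta> \<ge> 1\<close> for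
  \<open>N \<ge> 1\<close>; hence the constant \<open>c + N0\<close>.\<close>

lemma bigo_powr_imp_bound:
  fixes S :: "nat \<Rightarrow> real"
  assumes S: "S \<in> O(\<lambda>N. real N powr \<theta>)" and \<theta>: "\<theta> \<ge> 0" and le: "\<And>N. \<bar>S N\<bar> \<le> real N"
  obtains C where "C \<ge> 0" "\<And>N. \<bar>S N\<bar> \<le> C * real N powr \<theta>"
proof -
  obtain c where "c > 0" "eventually (\<lambda>N. norm (S N) \<le> c * norm (real N powr \<theta>)) sequentially"
    using landau_o.bigE[OF S] by blast
  then obtain N0 where c: "c > 0" "\<And>N. N \<ge> N0 \<Longrightarrow> \<bar>S N\<bar> \<le> c * real N powr \<theta>"
    by (auto simp: eventually_at_top_linorder)
  show ?thesis
  proof (rule that[of "c + real N0"])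
    show "c + real N0 \<ge> 0" using c by simp
    fix N
    show "\<bar>S N\<bar> \<le> (c + real N0) * real N powr \<theta>"
    proof (cases "N = 0")
      case True
      then show ?thesis using le[of 0] by simp
    next
      case False
      then have N1: "real N powr \<theta> \<ge> 1" using \<theta> by (simp add: ge_one_powr_ge_zero)
      show ?thesis
      proof (cases "N \<ge> N0")
        case True
        then have "\<bar>S N\<bar> \<le> c * real N powr \<theta>" by (rule c)
        also have "\<dots> \<le> (c + real N0) * real N powr \<theta>" by (intro mult_right_mono) auto
        finally show ?thesis .
      next
        case False
        then have "\<bar>S N\<bar> \<le> real N0 * 1" using le[of N] by simp
        also have "\<dots> \<le> (c + real N0) * real N powr \<theta>" using c N1 by (intro mult_mono) auto
        finally show ?thesis .
      qed
    qed
  qed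
qed

text \<open>In a probability space an almost sure statement that does not mention the sample point
  simply holds. This makes the hypothesis at \<open>t = 0\<close> deterministic.\<close>

lemma prob_space_ensemble: "prob_space (ensemble M)"
  unfolding ensemble_def by (intro prob_space_PiM prob_space_measure_pmf)

text \<open>Each prime contributes 1 except those dividing \<open>q\<close>, which lie in
  \<open>{1..q}\<close> and so number at most \<open>q\<close>.\<close>

lemma principal_sum_lower_bound:
  assumes chi: "dirichlet_character q chi" and q: "q > 0" and princ: "\<And>n. coprime n q \<Longrightarrow> chi n = 1"
  shows "real N - real q \<le> (\<Sum>n\<in>{1..N}. Re (chi (nth_prime n)))"
proof -
  have inj: "inj_on nth_prime {1..}"
  proof (rule inj_onI)
    fix x y assume *: "x \<in> {1..}" "y \<in> {1..}" "nth_prime x = nth_prime y"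
    then have "x - 1 = y - 1"
      using strict_mono_eq[OF strict_mono_enumerate[OF primes_infinite]] by (simp add: nth_prime_def)
    then show "x = y" using * by auto
  qed
  let ?D = "{n \<in> {1..N}. nth_prime n dvd q}"
  have "card ?D = card (nth_prime ` ?D)"
    by (rule card_image[symmetric]) (rule inj_on_subset[OF inj], auto)
  also have "\<dots> \<le> card {1..q}"
    using q by (intro card_mono) (auto dest: dvd_imp_le intro: nth_prime_prime prime_ge_1_nat)
  finally have D: "card ?D \<le> q" by simp
  have "real N - real q \<le> real N - real (card ?D)" using D by simp
  also have "\<dots> = (\<Sum>n\<in>{1..N}. 1 - (if nth_prime n dvd q then 1 else 0))"
    by (simp add: sum_subtractf sum.If_cases Int_def)
  also have "\<dots> \<le> (\<Sum>n\<in>{1..N}. Re (chi (nth_prime n)))"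
  proof (intro sum_mono)
    fix n
    show "1 - (if nth_prime n dvd q then 1 else 0) \<le> Re (chi (nth_prime n))"
    proof (cases "nth_prime n dvd q")
      case True
      have "\<not> coprime (nth_prime n) q"
        using coprime_common_divisor[of "nth_prime n" q "nth_prime n", OF _ dvd_refl True] not_prime_unit nth_prime_prime by blast
      then have "chi (nth_prime n) = 0" by (simp add: dirichlet_character_eq_0_iff[OF chi])
      then show ?thesis using True by simp
    next
      case False
      then have "coprime (nth_prime n) q" using nth_prime_prime by (auto intro: prime_imp_coprime)
      then show ?thesis using princ by simp
    qed
  qed
  finally show ?thesis .
qed

theorem theorem4:
  fixes q M :: nat and chi :: "nat \<Rightarrow> complex"
  assumes "q \<ge> 1" and "dirichlet_character q chi" and "M \<ge> 1"
    and "\<forall>\<epsilon>>0. \<forall>t::real. AE m in ensemble M.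
           (\<lambda>N. B_rand q chi m t N) \<in> O(\<lambda>N. real N powr (1/2 + \<epsilon>))"
  shows "RH_dirichlet chi"
proof -
  have q: "q > 0" and chi: "dirichlet_character q chi" using assms by auto
  define S where "S = (\<lambda>N. \<Sum>n\<in>{1..N}. Re (chi (nth_prime n)))"
  have S_le: "\<bar>S N\<bar> \<le> real N" for N
  proof -
    have "\<bar>S N\<bar> \<le> (\<Sum>n\<in>{1..N}. \<bar>Re (chi (nth_prime n))\<bar>)"
      unfolding S_def by (rule sum_abs)
    also have "\<dots> \<le> (\<Sum>n\<in>{1..N}. 1)"
      using abs_Re_le_cmod dirichlet_character_norm_le[OF chi q] order_trans by (intro sum_mono) blast
    finally show ?thesis by simp
  qed
  have S_bigo: "S \<in> O(\<lambda>N. real N powr (1/2 + \<epsilon>))" if "\<epsilon> > 0" for \<epsilon>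
  proof -
    have "AE m in ensemble M. (\<lambda>N. B_rand q chi m 0 N) \<in> O(\<lambda>N. real N powr (1/2 + \<epsilon>))"
      using assms(4) that by blast
    then show ?thesis
      unfolding B_rand_0[OF chi q] S_def by (simp add: prob_space.AE_const[OF prob_space_ensemble])
  qed
  have S_bound: "\<exists>C\<ge>0. \<forall>N. \<bar>S N\<bar> \<le> C * real N powr (1/2 + \<epsilon>)" if "\<epsilon> > 0" for \<epsilon>
    by (rule bigo_powr_imp_bound[OF S_bigo[OF that] _ S_le]) (use that in auto)
  have "\<exists>c. coprime c q \<and> chi c \<noteq> 1"
  proof (rule ccontr)
    assume "\<nexists>c. coprime c q \<and> chi c \<noteq> 1"
    then have low: "real N - real q \<le> S N" for N
      unfolding S_def by (intro principal_sum_lower_bound[OF chi q]) blast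
    \<comment> \<open>A principal character has linear growth \<open>N - q\<close>, against the
      bound of order \<open>N powr (3/4)\<close>. Evaluating at \<open>N = k ^ 4\<close> makes the
      fractional power the integer power \<open>k ^ 3\<close>, and \<open>k > C + q + 1\<close>
      gives the contradiction.\<close>
    obtain C where C: "C \<ge> 0" "\<And>N. \<bar>S N\<bar> \<le> C * real N powr (1/2 + 1/4)" using S_bound[of "1/4"] by auto
    obtain k where k: "real k > C + real q + 1" using reals_Archimedean2 by blast
    have k1: "real k \<ge> 1" using k C by simp
    have "real (k ^ 4) powr (1/2 + 1/4) = real k ^ 3"
    proof -
      have "real (k ^ 4) powr (1/2 + 1/4) = (real k powr 4) powr (3/4)"
        using k1 by simp
      also have "\<dots> = real k powr 3" unfolding powr_powr by simp
      finally show ?thesis using k1 by simp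
    qed
    then have "real k ^ 4 \<le> C * real k ^ 3 + real q"
      using low[of "k ^ 4"] C(2)[of "k ^ 4"] by simp
    also have "\<dots> \<le> C * real k ^ 3 + real q * real k ^ 3"
      using k1 by (simp add: mult_le_cancel_left1)
    also have "\<dots> = (C + real q) * real k ^ 3" by (simp add: distrib_right)
    also have "\<dots> < real k * real k ^ 3" using k k1 by (intro mult_strict_right_mono) auto
    finally show False by (simp add: power_eq_if)
  qed
  then obtain c where c: "coprime c q" "chi c \<noteq> 1" by blast
  have nonzero: "dirichlet_series chi s * dirichlet_series (\<lambda>n. cnj (chi n)) s \<noteq> 0" if s: "Re s > 1/2" for s
  proof -
    \<comment> \<open>Half the distance to the critical line, so that
      \<open>1/2 + \<epsilon>\<close> lies strictly to the left of \<open>Re s\<close>.\<close>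
    define \<epsilon> where "\<epsilon> = (Re s - 1/2) / 2"
    have \<epsilon>: "\<epsilon> > 0" "Re s > 1/2 + \<epsilon>" using s by (auto simp: \<epsilon>_def field_simps)
    obtain C where C: "C \<ge> 0" "\<And>N. \<bar>S N\<bar> \<le> C * real N powr (1/2 + \<epsilon>)" using S_bound[OF \<epsilon>(1)] by blast
    have "\<bar>\<Sum>k<n. if prime (Suc k) then Re (chi (Suc k)) else 0\<bar> \<le> C * real n powr (1/2 + \<epsilon>)" for n
    proof -
      obtain K where K: "K \<le> n" "(\<Sum>k<n. if prime (Suc k) then Re (chi (Suc k)) else 0) = S K"
        unfolding S_def using sum_primes_conv_nth_prime[of n "\<lambda>n. Re (chi n)"] by blast
      have "\<bar>S K\<bar> \<le> C * real K powr (1/2 + \<epsilon>)" by (rule C)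
      also have "\<dots> \<le> C * real n powr (1/2 + \<epsilon>)"
        using K(1) C(1) \<epsilon>(1) by (intro mult_left_mono powr_mono2) auto
      finally show ?thesis by (simp add: K(2))
    qed
    then show ?thesis
      using \<epsilon> by (intro dirichlet_L_nonzero[OF chi q c, of C "1/2 + \<epsilon>"]) auto
  qed
  show ?thesis
    unfolding RH_dirichlet_def
  proof (intro allI impI)
    fix f s assume f: "L_continuation chi f" and s: "0 < Re s \<and> Re s < 1 \<and> f s = 0"
    \<comment> \<open>Any continuation \<open>f\<close> agrees with the conditionally convergent
      series by the identity theorem. Nothing is known of \<open>f\<close> at 1, so the half-plane
      is punctured there; it remains connected and contains the strip.\<close>
    have "f s = dirichlet_series chi s"
    proof (rule analytic_continuation_open[of "{s. Re s > 1}" "{s. Re s > 0} - {1}" f "dirichlet_series chi"])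
      show "open {s. Re s > 1}" "open ({s. Re s > 0} - {1})"
        by (auto intro!: open_halfspace_Re_gt open_Diff)
      have "2 \<in> {s. Re s > 1}" by simp
      then show "{s. Re s > 1} \<noteq> {}" by blast
      show "connected ({s. Re s > 0} - {1})"
        by (intro connected_open_delete convex_connected convex_halfspace_Re_gt open_halfspace_Re_gt) auto
      show "{s. Re s > 1} \<subseteq> {s. Re s > 0} - {1}" by auto
      show "f holomorphic_on {s. Re s > 0} - {1}" using f by (simp add: L_continuation_def)
      show "dirichlet_series chi holomorphic_on {s. Re s > 0} - {1}"
        by (rule holomorphic_on_subset[OF dirichlet_L_holomorphic[OF chi q c]]) auto
      show "f z = dirichlet_series chi z" if "z \<in> {s. Re s > 1}" for z
        using f that by (simp add: L_continuation_def)
    qed (use s in auto)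
    then have zero: "dirichlet_series chi s = 0" using s by simp
    show "Re s = 1/2"
    proof (rule ccontr)
      assume "Re s \<noteq> 1/2"
      \<comment> \<open>A zero on the left reflects to a zero of the conjugate L-function at
        \<open>1 - s\<close> on the right, and the non-vanishing of the product covers both
        characters.\<close>
      then consider "Re s > 1/2" | "Re (1 - s) > 1/2" by fastforce
      then show False
      proof cases
        case 1
        then show ?thesis using nonzero zero by simp
      next
        case 2
        then show ?thesis
          using nonzero[OF 2] dirichlet_L_zero_reflection[OF chi q c _ _ zero] s by simp
      qed
    qed
  qed
qed

end
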